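(* Let $n=4k$ with $k\ge 1$. The maximum number of nonzero entries in an $n\times n$ symmetric alternating sign matrix all of whose main diagonal entries are $0$ equals $\frac{n^2-2n}{2}$ (equivalently, the maximum number of edges of an alternating signed graph of order $n$ without loops is $\frac{n^2-2n}{4}$). Moreover, an $n\times n$ symmetric ASM with zero main diagonal has exactly $\frac{n^2-2n}{2}$ nonzero entries if and only if it is a type 1 hollowed-diamond ASM, a type 2 hollowed-diamond ASM, or the hollowed-near-diamond ASM of order $n$.
   Context: An alternating sign matrix (ASM) is an $n\times n$ matrix with entries in $\{0,+1,-1\}$ such that in each row and each column the nonzero entries alternate in sign, beginning and ending with $+1$. An alternating signed graph of order $n$ without loops is a graph on vertices $1,\dots,n$ with edges signed $\pm1$ whose signed adjacency matrix is a symmetric ASM with zero main diagonal; its number of edges is half the number of nonzero entries. Let $n=4k$, $m=2k$. Let $D=[d_{ij}]$ be the $n\times n$ matrix with $d_{ij}=(-1)^{i+j-m-2}$ if $m+2\le i+j\le 3m$ and $|i-j|\le m$, and $d_{ij}=0$ otherwise; let $D'=[d'_{ij}]$ with $d'_{ij}=d_{n+1-i,j}$ (rows of $D$ reversed). Let $E=[e_{ij}]$ be the $n\times n$ matrix with $e_{ij}=(-1)^{i+j-2k-3}$ if $2k+3\le i+j\le 6k-1$ and $|i-j|\le 2k+1$, and $e_{ij}=0$ otherwise. The type 1 (resp. type 2) hollowed-diamond ASM of order $4k$ is obtained from $D$ (resp. $D'$) by setting to $0$ every entry in position $(i,j)$ with $\{i,j\}\subseteq\{k+2t-1,k+2t\}$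 for some $t\in\{1,\dots,k\}$. The hollowed-near-diamond ASM of order $4k$ is obtained from $E$ by setting to $0$ every entry in position $(i,j)$ with $\{i,j\}\subseteq\{k+2t,k+2t+1\}$ for some $t\in\{1,\dots,k-1\}$. *)

theory Defs
  imports Complex_Main "Jordan_Normal_Form.Matrix"
begin

text \<open>
  The mathematics numbers rows, columns and vertices from 1, whereas the matrices of type
  \<^typ>\<open>int mat\<close> are indexed from 0.  All explicit formulas below are stated with 1-based indices;
  the shift is made only where a matrix is built from them.
\<close>

definition alternating_from_to_one :: "int list \<Rightarrow> bool" where
  "alternating_from_to_one xs \<longleftrightarrow>
     (let ys = filter (\<lambda>x. x \<noteq> 0) xs
      in ys \<noteq> [] \<and> hd ys = 1 \<and> last ys = 1 \<and> successively (\<lambda>x y. sgn y = - sgn x) ys)"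

definition alternating_sign_matrix :: "nat \<Rightarrow> int mat \<Rightarrow> bool" where
  "alternating_sign_matrix n A \<longleftrightarrow>
     A \<in> carrier_mat n n \<and> elements_mat A \<subseteq> {0, 1, -1} \<and>
     (\<forall>i<n. alternating_from_to_one (list_of_vec (row A i))) \<and>
     (\<forall>j<n. alternating_from_to_one (list_of_vec (col A j)))"

definition hollow_symmetric_asm :: "nat \<Rightarrow> int mat \<Rightarrow> bool" where
  "hollow_symmetric_asm n A \<longleftrightarrow>
     alternating_sign_matrix n A \<and> transpose_mat A = A \<and> (\<forall>i<n. A $$ (i, i) = 0)"

definition num_nonzero :: "int mat \<Rightarrow> nat" where
  "num_nonzero A = card {(i, j). i < dim_row A \<and> j < dim_col A \<and> A $$ (i, j) \<noteq> 0}"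

text \<open>
  A signed graph without loops on the vertices \<open>1, \<dots>, n\<close> is a set of edges (two-element vertex
  sets) together with a sign function, of which only the values on the edges matter.
\<close>

definition loopless_signed_graph :: "nat \<Rightarrow> nat set set \<Rightarrow> (nat set \<Rightarrow> int) \<Rightarrow> bool" where
  "loopless_signed_graph n E \<sigma> \<longleftrightarrow>
     E \<subseteq> {e. e \<subseteq> {1..n} \<and> card e = 2} \<and> (\<forall>e\<in>E. \<sigma> e = 1 \<or> \<sigma> e = -1)"

definition signed_adjacency_mat :: "nat \<Rightarrow> nat set set \<Rightarrow> (nat set \<Rightarrow> int) \<Rightarrow> int mat" where
  "signed_adjacency_mat n E \<sigma> =
     mat n n (\<lambda>(i, j). if {i + 1, j + 1} \<in> E then \<sigma> {i + 1, j + 1} else 0)"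

definition alternating_loopless_signed_graph ::
    "nat \<Rightarrow> nat set set \<Rightarrow> (nat set \<Rightarrow> int) \<Rightarrow> bool" where
  "alternating_loopless_signed_graph n E \<sigma> \<longleftrightarrow>
     loopless_signed_graph n E \<sigma> \<and> hollow_symmetric_asm n (signed_adjacency_mat n E \<sigma>)"

text \<open>
  The entries of \<open>D\<close>, \<open>D'\<close> and \<open>E\<close> for \<open>n = 4k\<close>, \<open>m = 2k\<close>, at 1-based positions \<open>(i, j)\<close> with
  \<open>1 \<le> i, j \<le> n\<close>.  The natural-number subtractions in the exponents are exact under the guards.
\<close>

definition diamond_entry :: "nat \<Rightarrow> nat \<Rightarrow> nat \<Rightarrow> int" where
  "diamond_entry k i j =
     (let m = 2 * k in
      if m + 2 \<le> i + j \<and> i + j \<le> 3 * m \<and> \<bar>int i - int j\<bar> \<le> int m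
      then (-1) ^ (i + j - m - 2) else 0)"

definition reversed_diamond_entry :: "nat \<Rightarrow> nat \<Rightarrow> nat \<Rightarrow> int" where
  "reversed_diamond_entry k i j = diamond_entry k (4 * k + 1 - i) j"

definition near_diamond_entry :: "nat \<Rightarrow> nat \<Rightarrow> nat \<Rightarrow> int" where
  "near_diamond_entry k i j =
     (if 2 * k + 3 \<le> i + j \<and> i + j \<le> 6 * k - 1 \<and> \<bar>int i - int j\<bar> \<le> 2 * int k + 1
      then (-1) ^ (i + j - 2 * k - 3) else 0)"

definition hollowed_mat :: "nat \<Rightarrow> (nat \<Rightarrow> nat \<Rightarrow> int) \<Rightarrow> nat set set \<Rightarrow> int mat" where
  "hollowed_mat n f \<B> =
     mat n n (\<lambda>(i, j). if \<exists>B\<in>\<B>. {i + 1, j + 1} \<subseteq> B then 0 else f (i + 1) (j + 1))"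

definition hollowed_diamond_1 :: "nat \<Rightarrow> int mat" where
  "hollowed_diamond_1 k =
     hollowed_mat (4 * k) (diamond_entry k) {{k + 2 * t - 1, k + 2 * t} | t. t \<in> {1..k}}"

definition hollowed_diamond_2 :: "nat \<Rightarrow> int mat" where
  "hollowed_diamond_2 k =
     hollowed_mat (4 * k) (reversed_diamond_entry k) {{k + 2 * t - 1, k + 2 * t} | t. t \<in> {1..k}}"

definition hollowed_near_diamond :: "nat \<Rightarrow> int mat" where
  "hollowed_near_diamond k =
     hollowed_mat (4 * k) (near_diamond_entry k) {{k + 2 * t, k + 2 * t + 1} | t. t \<in> {1..k - 1}}"

end

theory Submission
  imports Defs
begin

text \<open>
  An ASM \<open>a\<close> is encoded by its height function \<open>h i j = i + j - 2 (\<Sum>x<i, y<j. a x y)\<close> on the grid of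
  cell corners: neighbouring heights differ by 1 and the heights on the frame are forced.  A
  cell is a zero of \<open>a\<close> iff the heights at one of its two pairs of opposite corners differ by 2, so
  counting zeros means counting, for each level \<open>q\<close>, the edges of the cut between \<open>h < q\<close> and
  \<open>h > q\<close> on the sublattice of corners with parity opposite to \<open>q\<close>.  By symmetry only the cells
  strictly above the diagonal matter; there the sublattice splits into layers parallel to the
  diagonal, and a cut edge lies either inside a layer or between two consecutive ones.

  Following how the number of sign changes decreases from layer to layer, every cut has, up to half
  the number of its sign changes on the diagonal, a lower bound attained in only two ways: the cut
  runs along the antidiagonal lines or along the layers.  Zero diagonal entries force the
  height to jump by 2 at every step along the diagonal, so there are \<open>n\<close> sign changes on the
  diagonal in total; summing over the levels gives at least \<open>4 k\<^sup>2\<close> zeros above the diagonal.  In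
  the case of equality all levels but the two middle ones, \<open>2 k\<close> and \<open>2 k + 1\<close>, are forced, and three of the
  four choices left there are consistent: they yield the three matrices of the theorem.
\<close>

section \<open>Cuts in layered arrays\<close>

text \<open>On the odd sublattice each level can be bounded alone. On the even one it cannot: its
  layer 0 is the diagonal, where a cut may end at no cost. What saves the count is that a cut edge
  between consecutive layers removes at most two sign changes, so the changes on the diagonal
  reappear as a term of the bound; single levels leave that term uncontrolled, but its total is
  known. For n = 4k the competing bounds are 2p and n - 2p at level 2p, and 4p - 6 and 2n + 2 - 4p
  (for twice the cost, beyond the diagonal term) at level 2p - 1. Each pair crosses once, with a
  tie: at p = k and at p = k + 1. That is why exactly the levels 2k and 2k + 1 stay free. Choosing
  there amounts to choosing, for each sublattice, the cap c in max (j - i) (min (i + j) (2n - i - j)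
  c). The fourth choice would put neighbouring heights 3 apart. The caps do not govern the diagonal;
  the zero entries do, by a recursion. Where its solution departs from the capped formula, the entry
  beside the diagonal is cancelled, and so the hollowed blocks arise.\<close>

lemma card_changes_le:
  fixes f g :: "nat \<Rightarrow> bool"
  assumes "f a = g a" "f b = g b"
  shows "card {m \<in> {a..<b}. f m \<noteq> f (Suc m)}
    \<le> card {m \<in> {a..<b}. g m \<noteq> g (Suc m)} + 2 * card {m \<in> {a<..<b}. f m \<noteq> g m}"
proof -
  let ?F = "{m \<in> {a..<b}. f m \<noteq> f (Suc m)}" and ?G = "{m \<in> {a..<b}. g m \<noteq> g (Suc m)}"
  let ?D = "{m \<in> {a<..<b}. f m \<noteq> g m}"
  \<comment> \<open>A position where \<open>f\<close> and \<open>g\<close> differ affects only the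
    two steps touching it, and the end points never differ.\<close>
  have "?F \<subseteq> ?G \<union> ?D \<union> (\<lambda>m. m - 1) ` ?D"
  proof
    fix m assume m: "m \<in> ?F"
    have "m \<in> ?G \<or> f m \<noteq> g m \<or> f (Suc m) \<noteq> g (Suc m)" using m by auto
    moreover have "m \<in> ?D" if "f m \<noteq> g m"
    proof -
      have "m \<noteq> a" using that assms by blast
      with that m show ?thesis by simp
    qed
    moreover have "m \<in> (\<lambda>m. m - 1) ` ?D" if "f (Suc m) \<noteq> g (Suc m)"
    proof -
      have "Suc m \<noteq> b" using that assms by blast
      with that m show ?thesis by (intro image_eqI[of _ _ "Suc m"]) simp_all
    qed
    ultimately show "m \<in> ?G \<union> ?D \<union> (\<lambda>m. m - 1) ` ?D" by blast
  qed
  then have "card ?F \<le> card (?G \<union> ?D \<union> (\<lambda>m. m - 1) ` ?D)"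
    by (intro card_mono) auto
  also have "\<dots> \<le> card ?G + card ?D + card ((\<lambda>m. m - 1) ` ?D)"
    using card_Un_le[of "?G \<union> ?D" "(\<lambda>m. m - 1) ` ?D"] card_Un_le[of ?G ?D] by linarith
  also have "\<dots> \<le> card ?G + card ?D + card ?D"
    by (simp add: card_image_le)
  finally show ?thesis by simp
qed

text \<open>The value at \<open>c\<close> must be reached from \<open>a\<close> and left again
  before \<open>b\<close>: one change on each side of \<open>c\<close>.\<close>

lemma two_le_card_changes:
  fixes f :: "nat \<Rightarrow> bool"
  assumes "f a = f b" "a \<le> c" "c \<le> b" "f c \<noteq> f a"
  shows "2 \<le> card {m \<in> {a..<b}. f m \<noteq> f (Suc m)}"
proof -
  have step: "\<exists>m \<in> {x..<y}. f m \<noteq> f (Suc m)" if "x \<le> y" "f x \<noteq> f y" for x y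
  proof (rule ccontr)
    assume "\<not> ?thesis"
    then have *: "f m = f (Suc m)" if "x \<le> m" "m < y" for m using that by auto
    have "f (x + d) = f x" if "x + d \<le> y" for d
      using that by (induction d) (use * in auto)
    from this[of "y - x"] \<open>x \<le> y\<close> \<open>f x \<noteq> f y\<close> show False by simp
  qed
  obtain m1 where m1: "m1 \<in> {a..<c}" "f m1 \<noteq> f (Suc m1)" using step[of a c] assms by blast
  obtain m2 where m2: "m2 \<in> {c..<b}" "f m2 \<noteq> f (Suc m2)" using step[of c b] assms by blast
  have "{m1, m2} \<subseteq> {m \<in> {a..<b}. f m \<noteq> f (Suc m)}" using m1 m2 by auto
  then have "card {m1, m2} \<le> card {m \<in> {a..<b}. f m \<noteq> f (Suc m)}" by (intro card_mono) auto
  moreover have "m1 \<noteq> m2" using m1 m2 by auto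
  ultimately show ?thesis by simp
qed

lemma constant_if_no_changes:
  fixes f :: "nat \<Rightarrow> bool"
  assumes "card {m \<in> {a..<b}. f m \<noteq> f (Suc m)} = 0" "a \<le> c" "c \<le> b"
  shows "f c = f a"
proof -
  have *: "f m = f (Suc m)" if "a \<le> m" "m < b" for m using assms(1) that by auto
  have "f (a + d) = f a" if "a + d \<le> b" for d
    using that by (induction d) (use * in auto)
  from this[of "c - a"] show ?thesis using assms by simp
qed

text \<open>
  Layer \<open>r\<close> stands for the line \<open>j - i = 2 r\<close> or \<open>j - i = 2 r + 1\<close>, and its points are indexed by \<open>m = i + r\<close>,
  so that points of consecutive layers on a common antidiagonal share the index \<open>m\<close>; layer \<open>r\<close>
  occupies \<open>r \<le> m \<le> M - r\<close>.  The entry \<open>w r m\<close> says that the height exceeds the level.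
\<close>

locale layered_cut =
  fixes M p R :: nat and w :: "nat \<Rightarrow> nat \<Rightarrow> bool"
  assumes R: "R = M div 2" and p: "1 \<le> p" "p \<le> R"
    and left_end: "\<And>r. r \<le> R \<Longrightarrow> w r r \<longleftrightarrow> p \<le> r"
    and right_end: "\<And>r. r \<le> R \<Longrightarrow> w r (M - r) \<longleftrightarrow> p \<le> r"
begin

lemma R_bounds: "2 * R \<le> M" "M \<le> Suc (2 * R)" using R by linarith+

definition row_changes :: "nat \<Rightarrow> nat set" where
  "row_changes r = {m \<in> {r..<M - r}. w r m \<noteq> w r (Suc m)}"

definition column_changes :: "nat \<Rightarrow> nat set" where
  "column_changes r = {m \<in> {r<..<M - r}. w r m \<noteq> w (Suc r) m}"

lemma finite_row_changes [simp]: "finite (row_changes r)" by (simp add: row_changes_def)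
lemma finite_column_changes [simp]: "finite (column_changes r)" by (simp add: column_changes_def)

text \<open>Each difference between layers \<open>r\<close> and \<open>Suc r\<close> costs at most
  two changes. Layer \<open>Suc r\<close> lacks one point at each end, and adding these two creates
  changes only where the frame values switch, between layers \<open>p - 1\<close> and
  \<open>p\<close>.\<close>

lemma card_row_changes_le:
  assumes "r < R"
  shows "card (row_changes r)
    \<le> card (row_changes (Suc r)) + 2 * card (column_changes r) + (if Suc r = p then 2 else 0)"
proof -
  \<comment> \<open>Layer \<open>Suc r\<close> lengthened to the extent of layer \<open>r\<close> by
    borrowing the two end values of the latter.\<close>
  define g where "g m = (if m = r \<or> m = M - r then w r m else w (Suc r) m)" for m
  have rM: "2 * r + 2 \<le> M" using assms R by linarith
  have "card (row_changes r) \<le> card {m \<in> {r..<M - r}. g m \<noteq> g (Suc m)}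
      + 2 * card {m \<in> {r<..<M - r}. w r m \<noteq> g m}"
    unfolding row_changes_def by (rule card_changes_le) (simp_all add: g_def)
  moreover have "{m \<in> {r<..<M - r}. w r m \<noteq> g m} = column_changes r"
    by (auto simp: column_changes_def g_def)
  moreover have "card {m \<in> {r..<M - r}. g m \<noteq> g (Suc m)}
      \<le> card (row_changes (Suc r)) + (if Suc r = p then 2 else 0)"
  proof -
    have ends: "w r r \<longleftrightarrow> p \<le> r" "w r (M - r) \<longleftrightarrow> p \<le> r"
      "w (Suc r) (Suc r) \<longleftrightarrow> p \<le> Suc r" "w (Suc r) (M - Suc r) \<longleftrightarrow> p \<le> Suc r"
      using assms left_end right_end by auto
    have inner: "m \<in> row_changes (Suc r)"
      if "m \<in> {r..<M - r}" "g m \<noteq> g (Suc m)" "m \<noteq> r" "m \<noteq> M - Suc r" for m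
      using that by (auto simp: row_changes_def g_def split: if_splits)
    have outer: "Suc r = p"
      if "m \<in> {r..<M - r}" "g m \<noteq> g (Suc m)" "m = r \<or> m = M - Suc r" for m
    proof (rule ccontr)
      assume "Suc r \<noteq> p"
      then have pr: "p \<le> Suc r \<longleftrightarrow> p \<le> r" by auto
      show False
      proof (cases "m = r")
        case True
        have "Suc r \<noteq> M - r" using rM by linarith
        with that(2) True have "w r r \<noteq> w (Suc r) (Suc r)" by (simp add: g_def)
        with ends pr show False by simp
      next
        case False
        with that have m: "m = M - Suc r" "Suc m = M - r" "m \<noteq> M - r" using rM by auto
        with False that(2) have "w (Suc r) (M - Suc r) \<noteq> w r (M - r)" by (simp add: g_def)
        with ends pr show False by simp
      qed
    qed
    have "{m \<in> {r..<M - r}. g m \<noteq> g (Suc m)}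
        \<subseteq> row_changes (Suc r) \<union> (if Suc r = p then {r, M - Suc r} else {})"
      using inner outer by auto
    then have "card {m \<in> {r..<M - r}. g m \<noteq> g (Suc m)}
        \<le> card (row_changes (Suc r) \<union> (if Suc r = p then {r, M - Suc r} else {}))"
      by (intro card_mono) auto
    also have "\<dots> \<le> card (row_changes (Suc r)) + card (if Suc r = p then {r, M - Suc r} else {})"
      by (rule card_Un_le)
    also have "card (if Suc r = p then {r, M - Suc r} else {}) \<le> (if Suc r = p then 2 else 0)"
      by (simp add: card_insert_if)
    finally show ?thesis by simp
  qed
  ultimately show ?thesis by simp
qed

lemma card_row_changes_le_chain:
  assumes "b \<le> R" "a \<le> b"
  shows "card (row_changes a) \<le> card (row_changes b) + 2 * (\<Sum>r = a..<b. card (column_changes r))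
    + (if a < p \<and> p \<le> b then 2 else 0)"
  using assms(2,1)
proof (induction b rule: dec_induct)
  case base
  show ?case by simp
next
  case (step b)
  have "card (row_changes b) \<le> card (row_changes (Suc b)) + 2 * card (column_changes b)
      + (if Suc b = p then 2 else 0)"
    using step by (intro card_row_changes_le) auto
  with step show ?case by (auto simp: sum.atLeastLessThan_Suc split: if_splits)
qed

text \<open>The last layer has one or two points, all of them on the frame and with equal
  values.\<close>

lemma row_changes_last: "row_changes R = {}"
proof -
  have "M - R = R \<or> M - R = Suc R" using R by linarith
  then show ?thesis
  proof
    assume "M - R = Suc R"
    then show ?thesis using left_end[of R] right_end[of R] by (auto simp: row_changes_def)
  qed (simp add: row_changes_def)
qed

text \<open>Every column \<open>m\<close> with p \<le> m \<le> M - p starts low in layer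
  \<open>s\<close> and ends high on the frame, so it changes at least once in between. There are M +
  1 - 2p such columns.\<close>

lemma column_changes_sum_ge_of_constant:
  assumes "s < p" and low: "\<And>m. s \<le> m \<Longrightarrow> m \<le> M - s \<Longrightarrow> \<not> w s m"
  shows "M + 1 \<le> 2 * p + (\<Sum>r = s..<R. card (column_changes r))"
proof -
  have ex: "\<exists>r \<in> {s..<R}. m \<in> column_changes r" if m: "p \<le> m" "m \<le> M - p" for m
  proof (rule ccontr)
    assume neg: "\<not> ?thesis"
    \<comment> \<open>The layer in which column \<open>m\<close> meets the frame.\<close>
    define e where "e = min m (M - m)"
    have e: "p \<le> e" "e \<le> R" "e \<le> m" "m \<le> M - e" "m = e \<or> m = M - e" "m \<le> M"
      using m R_bounds p unfolding e_def by linarith+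
    have "\<not> w (s + d) m" if "s + d \<le> e" for d
      using that
    proof (induction d)
      case 0
      then show ?case using low[of m] e \<open>s < p\<close> m by auto
    next
      case (Suc d)
      have "s + d \<in> {s..<R}" "m \<in> {s + d<..<M - (s + d)}" using Suc.prems e by auto
      then have "w (s + d) m = w (Suc (s + d)) m" using neg by (auto simp: column_changes_def)
      with Suc show ?case by auto
    qed
    from this[of "e - s"] have "\<not> w e m" using e \<open>s < p\<close> by simp
    moreover have "w e m" using left_end[of e] right_end[of e] e by auto
    ultimately show False by simp
  qed
  have "{p..M - p} \<subseteq> (\<Union>r \<in> {s..<R}. column_changes r)" using ex by auto
  then have "card {p..M - p} \<le> card (\<Union>r \<in> {s..<R}. column_changes r)" by (intro card_mono) auto
  also have "\<dots> \<le> (\<Sum>r = s..<R. card (column_changes r))" by (rule card_UN_le) simp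
  finally have "card {p..M - p} \<le> (\<Sum>r = s..<R. card (column_changes r))" .
  moreover have "2 * p \<le> M" using p R by linarith
  ultimately show ?thesis by simp
qed

text \<open>The last layer has no changes, so all changes of layer 0, except two that the frame may
  account for, must be removed by column changes, at most two by each.\<close>

lemma column_changes_sum_ge:
  "card (row_changes 0) \<le> 2 * (\<Sum>r<R. card (column_changes r)) + 2"
  using card_row_changes_le_chain[of R 0] by (simp add: row_changes_last lessThan_atLeast0 split: if_splits)

text \<open>Split at the constant layer \<open>s\<close>: the layers before it remove all changes of
  layer 0 without help from the frame, as \<open>s < p\<close>; those from \<open>s\<close> on pay
  for the columns that reach a high frame point.\<close>

lemma column_changes_sum_ge_of_constant':
  assumes "s < p" and low: "\<And>m. s \<le> m \<Longrightarrow> m \<le> M - s \<Longrightarrow> \<not> w s m"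
  shows "card (row_changes 0) + 2 * M + 2 \<le> 4 * p + 2 * (\<Sum>r<R. card (column_changes r))"
proof -
  have "row_changes s = {}" using low by (auto simp: row_changes_def)
  then have "card (row_changes 0) \<le> 2 * (\<Sum>r = 0..<s. card (column_changes r))"
    using card_row_changes_le_chain[of s 0] assms(1) p by (simp split: if_splits)
  moreover have "(\<Sum>r<R. card (column_changes r))
      = (\<Sum>r = 0..<s. card (column_changes r)) + (\<Sum>r = s..<R. card (column_changes r))"
    using assms(1) p by (subst sum.atLeastLessThan_concat) (auto simp: lessThan_atLeast0)
  moreover have "M + 1 \<le> 2 * p + (\<Sum>r = s..<R. card (column_changes r))"
    using assms(1) low by (rule column_changes_sum_ge_of_constant)
  ultimately show ?thesis by simp
qed

lemma two_le_card_row_changes: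
  assumes "s < p" "s \<le> m" "m \<le> M - s" "w s m"
  shows "2 \<le> card (row_changes s)"
  unfolding row_changes_def
  by (rule two_le_card_changes[of _ _ _ m]) (use assms left_end[of s] right_end[of s] p in auto)

lemma two_le_card_row_changes_sum:
  assumes "\<And>s. a \<le> s \<Longrightarrow> s < p \<Longrightarrow> \<exists>m. s \<le> m \<and> m \<le> M - s \<and> w s m"
  shows "2 * (p - a) \<le> (\<Sum>r = a..<p. card (row_changes r))"
proof -
  have "(\<Sum>r = a..<p. 2) \<le> (\<Sum>r = a..<p. card (row_changes r))"
    by (rule sum_mono) (use assms two_le_card_row_changes in force)
  then show ?thesis by simp
qed

lemma constant_layers:
  assumes "\<And>r. a \<le> r \<Longrightarrow> r \<le> R \<Longrightarrow> card (row_changes r) = 0"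
    and "a \<le> r" "r \<le> m" "m \<le> M - r"
  shows "w r m \<longleftrightarrow> p \<le> r"
proof -
  have "r \<le> R" using assms R by linarith
  then have "w r m = w r r"
    by (intro constant_if_no_changes[of r "M - r"]) (use assms in \<open>auto simp: row_changes_def\<close>)
  with left_end[OF \<open>r \<le> R\<close>] show ?thesis by simp
qed

lemma constant_columns:
  assumes "\<And>r. a \<le> r \<Longrightarrow> r < R \<Longrightarrow> card (column_changes r) = 0"
    and "a \<le> r" "r \<le> m" "m \<le> M - r"
  shows "w r m \<longleftrightarrow> p \<le> min m (M - m)"
proof -
  define e where "e = min m (M - m)"
  have e: "r \<le> e" "e \<le> R" "e \<le> m" "m \<le> M - e" "m = e \<or> m = M - e" "m \<le> M"
    using assms(2-4) R_bounds p unfolding e_def by linarith+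
  have "w (r + d) m = w r m" if "r + d \<le> e" for d
    using that
  proof (induction d)
    case (Suc d)
    have "r + d < R" "m \<in> {r + d<..<M - (r + d)}" using Suc.prems e by auto
    then have "w (r + d) m = w (Suc (r + d)) m"
      using assms(1)[of "r + d"] assms(2) by (auto simp: column_changes_def)
    with Suc show ?case by auto
  qed simp
  from this[of "e - r"] e have "w e m = w r m" by simp
  moreover have "w e m \<longleftrightarrow> p \<le> e" using left_end[of e] right_end[of e] e by auto
  ultimately show ?thesis by (simp add: e_def)
qed

section \<open>Costs of a cut and their two minimal shapes\<close>

text \<open>
  In the even sublattice layer 0 is the main diagonal, whose cells are not above the diagonal and
  therefore do not contribute.
\<close>

definition even_cost :: nat where
  "even_cost = (\<Sum>r<R. card (column_changes r)) + (\<Sum>r = 1..<R. card (row_changes r))"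

definition odd_cost :: nat where
  "odd_cost = (\<Sum>r<R. card (column_changes r)) + (\<Sum>r<R. card (row_changes r))"

text \<open>A column of constant \<open>m\<close> is an antidiagonal of the matrix. Here it is
  constant from layer \<open>a\<close> on and carries the value of its end on the frame, in layer
  \<open>min m (M - m)\<close>.\<close>

definition cut_by_columns :: "nat \<Rightarrow> bool" where
  "cut_by_columns a \<longleftrightarrow>
     (\<forall>r m. a \<le> r \<longrightarrow> r \<le> m \<longrightarrow> m \<le> M - r \<longrightarrow> (w r m \<longleftrightarrow> p \<le> min m (M - m)))"

definition cut_by_layers :: "nat \<Rightarrow> bool" where
  "cut_by_layers a \<longleftrightarrow>
     (\<forall>r m. a \<le> r \<longrightarrow> r \<le> m \<longrightarrow> m \<le> M - r \<longrightarrow> (w r m \<longleftrightarrow> p \<le> r))"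

lemma row_changes_zero_if_sum_zero:
  assumes "(\<Sum>r = a..<R. card (row_changes r)) = 0" "a \<le> r" "r \<le> R"
  shows "card (row_changes r) = 0"
  using assms row_changes_last by (cases "r = R") auto

text \<open>Each of the \<open>p - a\<close> summands is at least 2, so the bound on their sum
  leaves none of them room for more.\<close>

lemma row_changes_exact:
  assumes "\<And>s. a \<le> s \<Longrightarrow> s < p \<Longrightarrow> \<exists>m. s \<le> m \<and> m \<le> M - s \<and> w s m"
    and "(\<Sum>r = a..<p. card (row_changes r)) \<le> 2 * (p - a)" "a \<le> r" "r < p"
  shows "card (row_changes r) = 2"
proof -
  have ge: "2 \<le> card (row_changes s)" if "a \<le> s" "s < p" for s
    using assms(1)[OF that] two_le_card_row_changes that by blast
  have "(\<Sum>r = a..<p. card (row_changes r)) = card (row_changes r) + (\<Sum>s \<in> {a..<p} - {r}. card (row_changes s))"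
    using assms by (intro sum.remove) auto
  moreover have "(\<Sum>s \<in> {a..<p} - {r}. 2) \<le> (\<Sum>s \<in> {a..<p} - {r}. card (row_changes s))"
    by (rule sum_mono) (use ge in auto)
  moreover have "(\<Sum>s \<in> {a..<p} - {r}. 2) = 2 * (p - a) - (2::nat)"
    using assms by (simp add: card_Diff_singleton)
  moreover have "2 * (p - a) \<ge> 2" using assms by linarith
  ultimately show ?thesis using assms(2) ge[OF assms(3,4)] by linarith
qed

text \<open>The dichotomy is whether some layer strictly between layer 0 and layer \<open>p\<close>
  is entirely low. If so, column changes alone pay the second bound. If not, each of these
  \<open>p - 1\<close> layers has two row changes. The 6 consists of 2 for the frame and 4 for layer
  0, whose row changes are free.\<close>

lemma even_cost_cases:
  "card (row_changes 0) + 4 * p \<le> 2 * even_cost + 6 \<and>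
     (2 * even_cost + 6 = card (row_changes 0) + 4 * p \<longrightarrow> cut_by_columns 1) \<or>
   card (row_changes 0) + 2 * M + 2 \<le> 4 * p + 2 * even_cost \<and>
     (4 * p + 2 * even_cost = card (row_changes 0) + 2 * M + 2 \<longrightarrow> cut_by_layers 1)"
proof (cases "\<exists>s. 1 \<le> s \<and> s < p \<and> (\<forall>m. s \<le> m \<longrightarrow> m \<le> M - s \<longrightarrow> \<not> w s m)")
  case True
  then obtain s where s: "1 \<le> s" "s < p" "\<And>m. s \<le> m \<Longrightarrow> m \<le> M - s \<Longrightarrow> \<not> w s m" by blast
  have ge: "card (row_changes 0) + 2 * M + 2 \<le> 4 * p + 2 * (\<Sum>r<R. card (column_changes r))"
    using s(2,3) by (rule column_changes_sum_ge_of_constant')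
  have "cut_by_layers 1" if "4 * p + 2 * even_cost = card (row_changes 0) + 2 * M + 2"
  proof -
    have "(\<Sum>r = 1..<R. card (row_changes r)) = 0" using ge that unfolding even_cost_def by presburger
    from row_changes_zero_if_sum_zero[OF this] show ?thesis
      unfolding cut_by_layers_def by (intro allI impI constant_layers[of 1]) auto
  qed
  moreover have "card (row_changes 0) + 2 * M + 2 \<le> 4 * p + 2 * even_cost"
    using ge unfolding even_cost_def by simp
  ultimately show ?thesis by blast
next
  case False
  then have high: "\<exists>m. s \<le> m \<and> m \<le> M - s \<and> w s m" if "1 \<le> s" "s < p" for s using that by blast
  have ge: "2 * (p - 1) \<le> (\<Sum>r = 1..<p. card (row_changes r))"
    by (rule two_le_card_row_changes_sum) (use high in auto)
  have split: "(\<Sum>r = 1..<R. card (row_changes r))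
      = (\<Sum>r = 1..<p. card (row_changes r)) + (\<Sum>r = p..<R. card (row_changes r))"
    using p by (subst sum.atLeastLessThan_concat) auto
  have bsum: "card (row_changes 0) \<le> 2 * (\<Sum>r<R. card (column_changes r)) + 2" by (rule column_changes_sum_ge)
  have "cut_by_columns 1" if eq: "2 * even_cost + 6 = card (row_changes 0) + 4 * p"
  proof -
    have *: "(\<Sum>r = 1..<p. card (row_changes r)) \<le> 2 * (p - 1)"
      "(\<Sum>r = p..<R. card (row_changes r)) = 0"
      "card (row_changes 0) = 2 * (\<Sum>r<R. card (column_changes r)) + 2"
      using eq ge split bsum p unfolding even_cost_def by presburger+
    \<comment> \<open>Layer 1 and the frame together account for exactly two changes, so the column
      changes out of layer 0 must remove all others. By the equality in \<open>bsum\<close> this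
      uses up every column change, and none is left from layer 1 on.\<close>
    have "card (row_changes 1) + (if 1 = p then 2 else 0) = 2"
    proof (cases "p = 1")
      case True
      then show ?thesis using row_changes_zero_if_sum_zero[OF *(2), of 1] p by simp
    next
      case False
      then show ?thesis using row_changes_exact[of 1 1] high *(1) p by auto
    qed
    then have "card (row_changes 0) \<le> 2 * card (column_changes 0) + 2"
      using card_row_changes_le[of 0] p by simp
    moreover have "(\<Sum>r<R. card (column_changes r)) = card (column_changes 0) + (\<Sum>r = 1..<R. card (column_changes r))"
      using p by (simp add: lessThan_atLeast0 sum.atLeast_Suc_lessThan)
    ultimately have "(\<Sum>r = 1..<R. card (column_changes r)) = 0" using *(3) by linarith
    then have "card (column_changes r) = 0" if "1 \<le> r" "r < R" for r using that by auto
    then show ?thesis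
      unfolding cut_by_columns_def by (intro allI impI constant_columns[of 1]) auto
  qed
  moreover have "card (row_changes 0) + 4 * p \<le> 2 * even_cost + 6"
    using ge split bsum p unfolding even_cost_def by presburger
  ultimately show ?thesis by blast
qed

text \<open>The same dichotomy, now including layer 0: in the odd sublattice it lies above the
  diagonal and its changes are paid for, so no diagonal term appears.\<close>

lemma odd_cost_cases:
  "2 * p \<le> odd_cost \<and> (odd_cost = 2 * p \<longrightarrow> cut_by_columns 0) \<or>
   M + 1 \<le> 2 * p + odd_cost \<and> (2 * p + odd_cost = M + 1 \<longrightarrow> cut_by_layers 0)"
proof (cases "\<exists>s. s < p \<and> (\<forall>m. s \<le> m \<longrightarrow> m \<le> M - s \<longrightarrow> \<not> w s m)")
  case True
  then obtain s where s: "s < p" "\<And>m. s \<le> m \<Longrightarrow> m \<le> M - s \<Longrightarrow> \<not> w s m" by blast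
  have "M + 1 \<le> 2 * p + (\<Sum>r = s..<R. card (column_changes r))"
    using s by (rule column_changes_sum_ge_of_constant)
  also have "(\<Sum>r = s..<R. card (column_changes r)) \<le> (\<Sum>r<R. card (column_changes r))"
    by (intro sum_mono2) auto
  finally have ge: "M + 1 \<le> 2 * p + (\<Sum>r<R. card (column_changes r))" by simp
  have "cut_by_layers 0" if "2 * p + odd_cost = M + 1"
  proof -
    have "(\<Sum>r<R. card (row_changes r)) = 0" using ge that unfolding odd_cost_def by presburger
    then have "(\<Sum>r = 0..<R. card (row_changes r)) = 0" by (simp add: lessThan_atLeast0)
    from row_changes_zero_if_sum_zero[OF this] show ?thesis
      unfolding cut_by_layers_def by (intro allI impI constant_layers[of 0]) auto
  qed
  moreover have "M + 1 \<le> 2 * p + odd_cost"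
    using ge unfolding odd_cost_def by simp
  ultimately show ?thesis by blast
next
  case False
  then have high: "\<exists>m. s \<le> m \<and> m \<le> M - s \<and> w s m" if "s < p" for s using that by blast
  have ge: "2 * (p - 0) \<le> (\<Sum>r = 0..<p. card (row_changes r))"
    by (rule two_le_card_row_changes_sum) (use high in auto)
  have split: "(\<Sum>r<R. card (row_changes r))
      = (\<Sum>r = 0..<p. card (row_changes r)) + (\<Sum>r = p..<R. card (row_changes r))"
    using p by (subst sum.atLeastLessThan_concat) (auto simp: lessThan_atLeast0)
  have "cut_by_columns 0" if eq: "odd_cost = 2 * p"
  proof -
    have "(\<Sum>r<R. card (column_changes r)) = 0"
      using eq ge split unfolding odd_cost_def by presburger
    then have "card (column_changes r) = 0" if "r < R" for r using that by auto
    then show ?thesis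
      unfolding cut_by_columns_def by (intro allI impI constant_columns[of 0]) auto
  qed
  moreover have "2 * p \<le> odd_cost"
    using ge split unfolding odd_cost_def by presburger
  ultimately show ?thesis by blast
qed

end

section \<open>Heights above the diagonal\<close>

text \<open>Nothing is required below the diagonal; the assumption \<open>diagonal\<close> is what
  symmetry and a zero diagonal entry say about the corners on and above it.\<close>

locale height_function =
  fixes n k :: nat and h :: "nat \<Rightarrow> nat \<Rightarrow> int"
  assumes n: "n = 4 * k" and k: "1 \<le> k"
    and top: "\<And>j. j \<le> n \<Longrightarrow> h 0 j = int j"
    and right: "\<And>i. i \<le> n \<Longrightarrow> h i n = int n - int i"
    and horizontal: "\<And>i j. i \<le> j \<Longrightarrow> j < n \<Longrightarrow> \<bar>h i (Suc j) - h i j\<bar> = 1"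
    and vertical: "\<And>i j. i < j \<Longrightarrow> j \<le> n \<Longrightarrow> \<bar>h (Suc i) j - h i j\<bar> = 1"
    and diagonal: "\<And>i. i < n \<Longrightarrow> h i i + h (Suc i) (Suc i) = 2 * h i (Suc i)"
begin

lemma even_height_iff: "i \<le> j \<Longrightarrow> j \<le> n \<Longrightarrow> even (h i j) \<longleftrightarrow> even (i + j)"
proof (induction i)
  case 0
  then show ?case by (simp add: top)
next
  case (Suc i)
  have "h (Suc i) j = h i j + 1 \<or> h (Suc i) j = h i j - 1" using vertical[of i j] Suc.prems by arith
  with Suc show ?case by auto
qed

lemma height_le: "i \<le> j \<Longrightarrow> j \<le> n \<Longrightarrow> h i j \<le> int i + int j"
  and height_ge: "i \<le> j \<Longrightarrow> j \<le> n \<Longrightarrow> int j - int i \<le> h i j"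
proof (induction i)
  case 0
  { case 1 then show ?case by (simp add: top) }
  { case 2 then show ?case by (simp add: top) }
next
  case (Suc i)
  { case 1 then show ?case using Suc vertical[of i j] by force }
  { case 2 then show ?case using Suc vertical[of i j] by force }
qed

lemma height_le':
  assumes "i \<le> j" "j \<le> n"
  shows "h i j \<le> 2 * int n - int i - int j"
proof -
  have "h i (n - d) \<le> int n - int i + int d" if "i \<le> n - d" "d \<le> n" for d
    using that
  proof (induction d)
    case 0
    then show ?case by (simp add: right)
  next
    case (Suc d)
    then have "\<bar>h i (Suc (n - Suc d)) - h i (n - Suc d)\<bar> = 1" by (intro horizontal) auto
    moreover have "Suc (n - Suc d) = n - d" using Suc by simp
    moreover have "h i (n - d) \<le> int n - int i + int d" using Suc by simp
    ultimately show ?case by (simp add: abs_if split: if_splits)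
  qed
  from this[of "n - j"] assms show ?thesis by simp
qed

definition crosses :: "int \<Rightarrow> int \<Rightarrow> int \<Rightarrow> bool" where
  "crosses q x y \<longleftrightarrow> x < q \<and> q < y \<or> y < q \<and> q < x"

definition zero_cells :: "(nat \<times> nat) set" where
  "zero_cells = {(i, j). i < j \<and> j < n \<and>
     \<not> (h i j = h (Suc i) (Suc j) \<and> h i (Suc j) = h (Suc i) j)}"

definition cut :: "int \<Rightarrow> (nat \<times> nat) set" where
  "cut q = {(i, j). i < j \<and> j < n \<and>
     (crosses q (h i j) (h (Suc i) (Suc j)) \<or> crosses q (h i (Suc j)) (h (Suc i) j))}"

lemma finite_zero_cells: "finite zero_cells"
  by (rule finite_subset[of _ "{..<n} \<times> {..<n}"]) (auto simp: zero_cells_def)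

lemma cut_subset: "cut q \<subseteq> zero_cells"
  by (auto simp: cut_def zero_cells_def crosses_def)

text \<open>Since neighbours differ by 1, a cut cell has q - 1 and q + 1 at one pair of opposite
  corners and q at the other two. The corner sum therefore reveals the level, and cuts of different
  levels share no cell.\<close>

lemma cut_level:
  assumes "(i, j) \<in> cut q"
  shows "h i j + h (Suc i) (Suc j) + h i (Suc j) + h (Suc i) j = 4 * q"
proof -
  have "\<bar>h i (Suc j) - h i j\<bar> = 1" "\<bar>h (Suc i) (Suc j) - h (Suc i) j\<bar> = 1"
    "\<bar>h (Suc i) j - h i j\<bar> = 1" "\<bar>h (Suc i) (Suc j) - h i (Suc j)\<bar> = 1"
    using assms by (auto simp: cut_def intro!: horizontal vertical)
  moreover have "crosses q (h i j) (h (Suc i) (Suc j)) \<or> crosses q (h i (Suc j)) (h (Suc i) j)"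
    using assms by (auto simp: cut_def)
  ultimately show ?thesis unfolding crosses_def by arith
qed

lemma cut_disjoint: "q \<noteq> q' \<Longrightarrow> cut q \<inter> cut q' = {}"
proof (rule ccontr)
  assume "q \<noteq> q'" "cut q \<inter> cut q' \<noteq> {}"
  then obtain i j where "(i, j) \<in> cut q" "(i, j) \<in> cut q'" by auto
  from this[THEN cut_level] \<open>q \<noteq> q'\<close> show False by simp
qed

lemma finite_cut: "finite (cut q)"
  using finite_subset[OF cut_subset finite_zero_cells] .

lemma sum_card_cut_le:
  assumes "finite Q"
  shows "(\<Sum>q \<in> Q. card (cut q)) \<le> card zero_cells"
proof -
  have "(\<Sum>q \<in> Q. card (cut q)) = card (\<Union>q \<in> Q. cut q)"
    using assms finite_cut cut_disjoint by (intro card_UN_disjoint[symmetric]) auto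
  also have "\<dots> \<le> card zero_cells"
    using cut_subset by (intro card_mono finite_zero_cells) auto
  finally show ?thesis .
qed

definition layer :: "nat \<Rightarrow> int \<Rightarrow> nat \<Rightarrow> nat \<Rightarrow> bool" where
  "layer e q r m \<longleftrightarrow> q < h (m - r) (m + r + e)"

text \<open>Each counted change crosses a cell of the cut, and distinct changes give distinct cells.
  Heights on the sublattice never equal \<open>q\<close>, by parity, so a change of the truth value
  really crosses \<open>q\<close>. The assumption on \<open>a\<close> and \<open>e\<close> keeps the
  cells of row changes off the diagonal.\<close>

lemma cost_le_card_cut:
  assumes cut: "layered_cut (n - e) p R (layer e q)"
    and e: "e \<le> 1" and parity: "even q \<noteq> even e" and a: "1 \<le> a + e"
  shows "(\<Sum>r<R. card (layered_cut.column_changes (n - e) (layer e q) r))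
    + (\<Sum>r = a..<R. card (layered_cut.row_changes (n - e) (layer e q) r)) \<le> card (cut q)"
proof -
  interpret layered_cut "n - e" p R "layer e q" by (rule cut)
  define S1 where "S1 = (SIGMA r : {..<R}. column_changes r)"
  define S2 where "S2 = (SIGMA r : {a..<R}. row_changes r)"
  \<comment> \<open>Upper left corners of the crossed cells: a column change joins the upper right
    and lower left corners of its cell, a row change the other two. The parity of the coordinate sum
    tells the two kinds apart.\<close>
  define f1 where "f1 = (\<lambda>(r, m). (m - Suc r, m + r + e))"
  define f2 where "f2 = (\<lambda>(r, m). (m - r, m + r + e))"
  have fin: "finite S1" "finite S2" unfolding S1_def S2_def by auto
  have nq: "h (m - r) (m + r + e) \<noteq> q" if "r \<le> m" "m + r + e \<le> n" for r m
  proof -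
    have "even (h (m - r) (m + r + e)) \<longleftrightarrow> even e" using that by (subst even_height_iff) auto
    with parity show ?thesis by auto
  qed
  have inj1: "inj_on f1 S1" by (rule inj_onI) (auto simp: S1_def f1_def column_changes_def)
  have inj2: "inj_on f2 S2" by (rule inj_onI) (auto simp: S2_def f2_def row_changes_def)
  have odd1: "odd (fst x + snd x + e)" if "x \<in> f1 ` S1" for x
    using that by (auto simp: S1_def f1_def column_changes_def)
  have even2: "even (fst x + snd x + e)" if "x \<in> f2 ` S2" for x
    using that by (auto simp: S2_def f2_def row_changes_def)
  have disj: "f1 ` S1 \<inter> f2 ` S2 = {}" using odd1 even2 by blast
  have sub1: "f1 ` S1 \<subseteq> cut q"
  proof
    fix x assume "x \<in> f1 ` S1"
    then obtain r m where x: "x = (m - Suc r, m + r + e)" and "m \<in> column_changes r"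
      by (auto simp: S1_def f1_def)
    then have m: "r < m" "m < n - e - r" "layer e q r m \<noteq> layer e q (Suc r) m"
      by (auto simp: column_changes_def)
    have "h (m - r) (m + r + e) \<noteq> q" by (rule nq) (use m in auto)
    moreover have "h (m - Suc r) (m + Suc r + e) \<noteq> q" by (rule nq) (use m in auto)
    ultimately have c: "crosses q (h (m - Suc r) (m + Suc r + e)) (h (m - r) (m + r + e))"
      using m(3) unfolding layer_def crosses_def by linarith
    have "Suc (m - Suc r) = m - r" "Suc (m + r + e) = m + Suc r + e"
      "m - Suc r < m + r + e" "m + r + e < n" using m by linarith+
    then show "x \<in> cut q"
      by (simp only: x cut_def mem_Collect_eq case_prod_conv c simp_thms)
  qed
  have sub2: "f2 ` S2 \<subseteq> cut q"
  proof
    fix x assume "x \<in> f2 ` S2"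
    then obtain r m where x: "x = (m - r, m + r + e)" and "m \<in> row_changes r" "a \<le> r"
      by (auto simp: S2_def f2_def)
    then have m: "r \<le> m" "m < n - e - r" "layer e q r m \<noteq> layer e q r (Suc m)"
      by (auto simp: row_changes_def)
    have "h (m - r) (m + r + e) \<noteq> q" by (rule nq) (use m in auto)
    moreover have "h (Suc m - r) (Suc m + r + e) \<noteq> q" by (rule nq) (use m in auto)
    ultimately have c: "crosses q (h (m - r) (m + r + e)) (h (Suc m - r) (Suc m + r + e))"
      using m(3) unfolding layer_def crosses_def by linarith
    have "Suc (m - r) = Suc m - r" "Suc (m + r + e) = Suc m + r + e"
      "m - r < m + r + e" "m + r + e < n" using m \<open>a \<le> r\<close> a by linarith+
    then show "x \<in> cut q"
      by (simp only: x cut_def mem_Collect_eq case_prod_conv c simp_thms)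
  qed
  have "(\<Sum>r<R. card (column_changes r)) + (\<Sum>r = a..<R. card (row_changes r)) = card S1 + card S2"
    unfolding S1_def S2_def by (simp add: card_SigmaI)
  also have "\<dots> = card (f1 ` S1 \<union> f2 ` S2)"
    using inj1 inj2 disj fin by (simp add: card_Un_disjoint card_image)
  also have "\<dots> \<le> card (cut q)"
    using sub1 sub2 by (intro card_mono finite_cut) auto
  finally show ?thesis .
qed

section \<open>The two sublattices as layered cuts, and the changes on the diagonal\<close>

lemma even_layers:
  assumes "1 \<le> p" "p \<le> 2 * k"
  shows "layered_cut n p (2 * k) (layer 0 (2 * int p - 1))"
proof
  show "2 * k = n div 2" by (simp add: n)
  fix r assume r: "r \<le> 2 * k"
  show "layer 0 (2 * int p - 1) r r \<longleftrightarrow> p \<le> r"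
    using r n by (auto simp: layer_def top)
  have "h (n - r - r) (n - r + r + 0) = 2 * int r"
    using r n right[of "n - r - r"] by simp
  then show "layer 0 (2 * int p - 1) r (n - r) \<longleftrightarrow> p \<le> r"
    unfolding layer_def by (simp only:) auto
qed (use assms in auto)

lemma odd_layers:
  assumes "1 \<le> p" "p \<le> 2 * k - 1"
  shows "layered_cut (n - 1) p (2 * k - 1) (layer 1 (2 * int p))"
proof
  show "2 * k - 1 = (n - 1) div 2" using n k by linarith
  fix r assume r: "r \<le> 2 * k - 1"
  show "layer 1 (2 * int p) r r \<longleftrightarrow> p \<le> r"
    using r n k by (auto simp: layer_def top)
  have "n - 1 - r + r + 1 = n" "n - 1 - r - r \<le> n" using r n k by auto
  then have "h (n - 1 - r - r) (n - 1 - r + r + 1) = 2 * int r + 1"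
    using r n k right[of "n - 1 - r - r"] by simp
  then show "layer 1 (2 * int p) r (n - 1 - r) \<longleftrightarrow> p \<le> r"
    unfolding layer_def by (simp only:) auto
qed (use assms in auto)

definition diagonal_changes :: "nat \<Rightarrow> nat" where
  "diagonal_changes p = card (layered_cut.row_changes n (layer 0 (2 * int p - 1)) 0)"

text \<open>Step \<open>m\<close> along the diagonal moves the height by 2, across the odd value
  \<open>h m (Suc m)\<close>. That value is the level 2p - 1 at which the step is counted.\<close>

lemma sum_diagonal_changes: "n \<le> (\<Sum>p = 1..2 * k. diagonal_changes p)"
proof -
  define P where "P p m \<longleftrightarrow> (2 * int p - 1 < h m m) \<noteq> (2 * int p - 1 < h (Suc m) (Suc m))" for p m
  have dc: "diagonal_changes p = (\<Sum>m<n. of_bool (P p m))" if "p \<in> {1..2 * k}" for p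
  proof -
    interpret layered_cut n p "2 * k" "layer 0 (2 * int p - 1)" using that even_layers by simp
    have "row_changes 0 = {m \<in> {..<n}. P p m}"
      by (auto simp: row_changes_def layer_def P_def)
    then show ?thesis unfolding diagonal_changes_def by (simp add: sum.If_cases of_bool_def Int_def)
  qed
  have "1 \<le> (\<Sum>p = 1..2 * k. of_bool (P p m) :: nat)" if m: "m < n" for m
  proof -
    have b: "0 \<le> h m m" "h m m \<le> int n" "0 \<le> h (Suc m) (Suc m)" "h (Suc m) (Suc m) \<le> int n"
      using height_ge[of m m] height_le[of m m] height_le'[of m m]
        height_ge[of "Suc m" "Suc m"] height_le[of "Suc m" "Suc m"] height_le'[of "Suc m" "Suc m"] m
      by auto
    have step: "\<bar>h m (Suc m) - h m m\<bar> = 1" "h m m + h (Suc m) (Suc m) = 2 * h m (Suc m)"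
      using m horizontal diagonal by auto
    have "odd (h m (Suc m))" using m by (simp add: even_height_iff)
    then obtain t where t: "h m (Suc m) = 2 * t + 1" by (elim oddE)
    define p where "p = nat (t + 1)"
    have "p \<in> {1..2 * k}" "2 * int p - 1 = h m (Suc m)"
      using b step t n unfolding p_def by auto
    moreover from this have "P p m" using step unfolding P_def by auto
    ultimately have "of_bool (P p m) \<le> (\<Sum>p = 1..2 * k. of_bool (P p m) :: nat)"
      by (intro member_le_sum) auto
    with \<open>P p m\<close> show ?thesis by simp
  qed
  then have "(\<Sum>m<n. 1) \<le> (\<Sum>m<n. \<Sum>p = 1..2 * k. of_bool (P p m) :: nat)"
    by (intro sum_mono) auto
  also have "\<dots> = (\<Sum>p = 1..2 * k. \<Sum>m<n. of_bool (P p m))" by (rule sum.swap)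
  also have "\<dots> = (\<Sum>p = 1..2 * k. diagonal_changes p)" using dc by (intro sum.cong) auto
  finally show ?thesis by simp
qed

end

section \<open>The lower bound and its equality case\<close>

lemma sum_even_bounds:
  "(\<Sum>p = 1..2 * k. if p \<le> k then 4 * int p - 6 else 8 * int k + 2 - 4 * int p)
    = 4 * int k * int k - 4 * int k"
proof -
  let ?f = "\<lambda>p. if p \<le> k then 4 * int p - 6 else 8 * int k + 2 - 4 * int p"
  have 1: "(\<Sum>p = 1..m. 4 * int p - 6) = 2 * int m * int m - 4 * int m" for m
    by (induction m) (simp_all add: algebra_simps)
  have 2: "(\<Sum>p = Suc k..k + m. 8 * int k + 2 - 4 * int p) = int m * (4 * int k - 2 * int m)" for m
    by (induction m) (simp_all add: algebra_simps)
  have "{1..2 * k} = {1..k} \<union> {Suc k..k + k}" by auto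
  then have "(\<Sum>p = 1..2 * k. ?f p) = (\<Sum>p = 1..k. ?f p) + (\<Sum>p = Suc k..k + k. ?f p)"
    by (simp add: sum.union_disjoint)
  also have "(\<Sum>p = 1..k. ?f p) = (\<Sum>p = 1..k. 4 * int p - 6)" by (intro sum.cong) auto
  also have "(\<Sum>p = Suc k..k + k. ?f p) = (\<Sum>p = Suc k..k + k. 8 * int k + 2 - 4 * int p)"
    by (intro sum.cong) auto
  finally show ?thesis unfolding 1 2 by (simp add: algebra_simps)
qed

lemma sum_odd_bounds:
  assumes "1 \<le> k"
  shows "(\<Sum>p = 1..2 * k - 1. if p \<le> k then 2 * int p else 4 * int k - 2 * int p)
    = 2 * int k * int k"
proof -
  let ?f = "\<lambda>p. if p \<le> k then 2 * int p else 4 * int k - 2 * int p"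
  have 1: "(\<Sum>p = 1..m. 2 * int p) = int m * int m + int m" for m
    by (induction m) (simp_all add: algebra_simps)
  have 2: "(\<Sum>p = Suc k..k + m. 4 * int k - 2 * int p) = int m * (2 * int k - 1 - int m)" for m
    by (induction m) (simp_all add: algebra_simps)
  have "{1..2 * k - 1} = {1..k} \<union> {Suc k..k + (k - 1)}" using assms by auto
  then have "(\<Sum>p = 1..2 * k - 1. ?f p)
      = (\<Sum>p = 1..k. ?f p) + (\<Sum>p = Suc k..k + (k - 1). ?f p)"
    by (simp add: sum.union_disjoint)
  also have "(\<Sum>p = 1..k. ?f p) = (\<Sum>p = 1..k. 2 * int p)" by (intro sum.cong) auto
  also have "(\<Sum>p = Suc k..k + (k - 1). ?f p) = (\<Sum>p = Suc k..k + (k - 1). 4 * int k - 2 * int p)"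
    by (intro sum.cong) auto
  finally show ?thesis unfolding 1 2 using assms by (simp add: algebra_simps of_nat_diff)
qed

text \<open>For i \<le> j the distance j - i and the minimum of i + j and 2n - i - j are the least
  and the greatest height that the frame allows. Levels below the cap are cut along antidiagonals,
  those above it along layers; each sublattice has its own cap.\<close>

definition profile :: "nat \<Rightarrow> int \<Rightarrow> int \<Rightarrow> nat \<Rightarrow> nat \<Rightarrow> int" where
  "profile n ce co i j = max \<bar>int j - int i\<bar>
     (min (min (int i + int j) (2 * int n - int i - int j)) (if even (i + j) then ce else co))"

context height_function
begin

section \<open>Costs of the single levels and their sum\<close>

definition even_level_cost :: "nat \<Rightarrow> nat" where
  "even_level_cost p = layered_cut.even_cost n (2 * k) (layer 0 (2 * int p - 1))"

definition odd_level_cost :: "nat \<Rightarrow> nat" where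
  "odd_level_cost p = layered_cut.odd_cost (n - 1) (2 * k - 1) (layer 1 (2 * int p))"

lemma sum_cost_le:
  "(\<Sum>p = 1..2 * k. even_level_cost p) + (\<Sum>p = 1..2 * k - 1. odd_level_cost p) \<le> card zero_cells"
proof -
  have e: "even_level_cost p \<le> card (cut (2 * int p - 1))" if "p \<in> {1..2 * k}" for p
  proof -
    have L: "layered_cut n p (2 * k) (layer 0 (2 * int p - 1))" using that even_layers by simp
    then show ?thesis
      using cost_le_card_cut[of 0 p "2 * k" "2 * int p - 1" 1]
      by (simp add: even_level_cost_def layered_cut.even_cost_def[OF L])
  qed
  have o: "odd_level_cost p \<le> card (cut (2 * int p))" if "p \<in> {1..2 * k - 1}" for p
  proof -
    have L: "layered_cut (n - 1) p (2 * k - 1) (layer 1 (2 * int p))" using that odd_layers by simp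
    then show ?thesis
      using cost_le_card_cut[of 1 p "2 * k - 1" "2 * int p" 0]
      unfolding odd_level_cost_def layered_cut.odd_cost_def[OF L] lessThan_atLeast0 by simp
  qed
  let ?E = "(\<lambda>p. 2 * int p - 1) ` {1..2 * k}" and ?O = "(\<lambda>p. 2 * int p) ` {1..2 * k - 1}"
  have "?E \<inter> ?O = {}" by auto presburger
  have "(\<Sum>p = 1..2 * k. card (cut (2 * int p - 1))) + (\<Sum>p = 1..2 * k - 1. card (cut (2 * int p)))
      = (\<Sum>q \<in> ?E. card (cut q)) + (\<Sum>q \<in> ?O. card (cut q))"
    by (simp add: sum.reindex inj_on_def)
  also have "\<dots> = (\<Sum>q \<in> ?E \<union> ?O. card (cut q))"
    using \<open>?E \<inter> ?O = {}\<close> by (intro sum.union_disjoint[symmetric]) auto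
  also have "\<dots> \<le> card zero_cells" by (rule sum_card_cut_le) auto
  finally have "(\<Sum>p = 1..2 * k. card (cut (2 * int p - 1)))
      + (\<Sum>p = 1..2 * k - 1. card (cut (2 * int p))) \<le> card zero_cells" .
  moreover have "(\<Sum>p = 1..2 * k. even_level_cost p) \<le> (\<Sum>p = 1..2 * k. card (cut (2 * int p - 1)))"
    by (rule sum_mono) (rule e)
  moreover have "(\<Sum>p = 1..2 * k - 1. odd_level_cost p) \<le> (\<Sum>p = 1..2 * k - 1. card (cut (2 * int p)))"
    by (rule sum_mono) (rule o)
  ultimately show ?thesis by linarith
qed

text \<open>The smaller of the two bounds on twice the cost, without the diagonal term. They
  coincide at p = k + 1 only, which leaves the level 2k + 1 undecided.\<close>

definition even_bound :: "nat \<Rightarrow> int" where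
  "even_bound p = (if p \<le> k then 4 * int p - 6 else 8 * int k + 2 - 4 * int p)"

text \<open>The smaller of 2p and n - 2p; the tie is at p = k, the level 2k.\<close>

definition odd_bound :: "nat \<Rightarrow> int" where
  "odd_bound p = (if p \<le> k then 2 * int p else 4 * int k - 2 * int p)"

definition columns_even :: "nat \<Rightarrow> bool" where
  "columns_even p = layered_cut.cut_by_columns n p (layer 0 (2 * int p - 1)) 1"
definition layers_even :: "nat \<Rightarrow> bool" where
  "layers_even p = layered_cut.cut_by_layers n p (layer 0 (2 * int p - 1)) 1"
definition columns_odd :: "nat \<Rightarrow> bool" where
  "columns_odd p = layered_cut.cut_by_columns (n - 1) p (layer 1 (2 * int p)) 0"
definition layers_odd :: "nat \<Rightarrow> bool" where
  "layers_odd p = layered_cut.cut_by_layers (n - 1) p (layer 1 (2 * int p)) 0"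

lemma even_level:
  assumes "p \<in> {1..2 * k}"
  shows "int (diagonal_changes p) + even_bound p \<le> 2 * int (even_level_cost p)"
    and "2 * int (even_level_cost p) = int (diagonal_changes p) + even_bound p \<Longrightarrow>
      columns_even p \<and> p \<le> k + 1 \<or> layers_even p \<and> k + 1 \<le> p"
proof -
  interpret layered_cut n p "2 * k" "layer 0 (2 * int p - 1)" using assms even_layers by simp
  note cases = even_cost_cases[folded diagonal_changes_def even_level_cost_def columns_even_def
    layers_even_def]
  show "int (diagonal_changes p) + even_bound p \<le> 2 * int (even_level_cost p)"
    using cases n unfolding even_bound_def by (cases "p \<le> k") auto
  show "columns_even p \<and> p \<le> k + 1 \<or> layers_even p \<and> k + 1 \<le> p"
    if "2 * int (even_level_cost p) = int (diagonal_changes p) + even_bound p"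
    using cases that n unfolding even_bound_def by (cases "p \<le> k") (auto split: if_splits)
qed

lemma odd_level:
  assumes "p \<in> {1..2 * k - 1}"
  shows "odd_bound p \<le> int (odd_level_cost p)"
    and "int (odd_level_cost p) = odd_bound p \<Longrightarrow>
      columns_odd p \<and> p \<le> k \<or> layers_odd p \<and> k \<le> p"
proof -
  interpret layered_cut "n - 1" p "2 * k - 1" "layer 1 (2 * int p)" using assms odd_layers by simp
  note cases = odd_cost_cases[folded odd_level_cost_def columns_odd_def layers_odd_def]
  show "odd_bound p \<le> int (odd_level_cost p)"
    using cases n k unfolding odd_bound_def by (cases "p \<le> k") auto
  show "columns_odd p \<and> p \<le> k \<or> layers_odd p \<and> k \<le> p"
    if "int (odd_level_cost p) = odd_bound p"
    using cases that n k unfolding odd_bound_def by (cases "p \<le> k") (auto split: if_splits)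
qed

text \<open>The even bounds concern doubled costs, hence the factor 2 on the odd ones;
  \<open>int n\<close> stands for the total of the diagonal changes.\<close>

lemma total_bounds:
  "int n + (\<Sum>p = 1..2 * k. even_bound p) + 2 * (\<Sum>p = 1..2 * k - 1. odd_bound p)
    = 8 * int k * int k"
  using sum_even_bounds[of k] sum_odd_bounds[OF k] n unfolding even_bound_def odd_bound_def by simp

definition slack :: "nat \<Rightarrow> int" where
  "slack p = 2 * int (even_level_cost p) - int (diagonal_changes p) - even_bound p"

definition slack' :: "nat \<Rightarrow> int" where
  "slack' p = int (odd_level_cost p) - odd_bound p"

text \<open>All slacks are nonnegative, so this yields both the lower bound on the zeros and, when
  it is attained, the tightness of every single level.\<close>

lemma sum_slack_le:
  "(\<Sum>p = 1..2 * k. slack p) + 2 * (\<Sum>p = 1..2 * k - 1. slack' p)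
    \<le> 2 * int (card zero_cells) - 8 * int k * int k"
proof -
  have "int n \<le> (\<Sum>p = 1..2 * k. int (diagonal_changes p))"
    using sum_diagonal_changes by (metis of_nat_le_iff of_nat_sum)
  moreover have "(\<Sum>p = 1..2 * k. int (even_level_cost p))
      + (\<Sum>p = 1..2 * k - 1. int (odd_level_cost p)) \<le> int (card zero_cells)"
    using sum_cost_le by (metis of_nat_le_iff of_nat_sum of_nat_add)
  ultimately show ?thesis using total_bounds
    unfolding slack_def slack'_def by (simp add: sum_subtractf sum_distrib_left[symmetric])
qed

lemma slack_nonneg:
  "p \<in> {1..2 * k} \<Longrightarrow> 0 \<le> slack p" "p \<in> {1..2 * k - 1} \<Longrightarrow> 0 \<le> slack' p"
  using even_level(1) odd_level(1) unfolding slack_def slack'_def by force+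

lemma zero_cells_ge: "4 * k * k \<le> card zero_cells"
proof -
  have "0 \<le> (\<Sum>p = 1..2 * k. slack p)" "0 \<le> (\<Sum>p = 1..2 * k - 1. slack' p)"
    using slack_nonneg by (intro sum_nonneg; blast)+
  with sum_slack_le have "4 * int k * int k \<le> int (card zero_cells)" by linarith
  then show ?thesis by (metis of_nat_le_iff of_nat_mult of_nat_numeral)
qed

lemma tight_levels:
  assumes "card zero_cells = 4 * k * k"
  shows "p \<in> {1..2 * k} \<Longrightarrow> columns_even p \<and> p \<le> k + 1 \<or> layers_even p \<and> k + 1 \<le> p"
    and "p \<in> {1..2 * k - 1} \<Longrightarrow> columns_odd p \<and> p \<le> k \<or> layers_odd p \<and> k \<le> p"
proof -
  have s: "0 \<le> (\<Sum>p = 1..2 * k. slack p)" "0 \<le> (\<Sum>p = 1..2 * k - 1. slack' p)"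
    using slack_nonneg by (intro sum_nonneg; blast)+
  have "(\<Sum>p = 1..2 * k. slack p) + 2 * (\<Sum>p = 1..2 * k - 1. slack' p) \<le> 0"
    using sum_slack_le assms by simp
  with s have z: "(\<Sum>p = 1..2 * k. slack p) = 0" "(\<Sum>p = 1..2 * k - 1. slack' p) = 0" by linarith+
  have e: "slack p = 0" if "p \<in> {1..2 * k}" for p
    using z(1) slack_nonneg(1) that by (subst (asm) sum_nonneg_eq_0_iff) auto
  have o: "slack' p = 0" if "p \<in> {1..2 * k - 1}" for p
    using z(2) slack_nonneg(2) that by (subst (asm) sum_nonneg_eq_0_iff) auto
  show "p \<in> {1..2 * k} \<Longrightarrow> columns_even p \<and> p \<le> k + 1 \<or> layers_even p \<and> k + 1 \<le> p"
    using e even_level(2)[of p] unfolding slack_def by fastforce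
  show "p \<in> {1..2 * k - 1} \<Longrightarrow> columns_odd p \<and> p \<le> k \<or> layers_odd p \<and> k \<le> p"
    using o odd_level(2)[of p] unfolding slack'_def by fastforce
qed

section \<open>Recovering the heights from tight levels\<close>

lemma columns_even_iff:
  assumes "columns_even p" "p \<in> {1..2 * k}" "i < j" "j \<le> n" "even (i + j)"
  shows "2 * int p - 1 < h i j \<longleftrightarrow> 2 * int p - 1 < min (int i + int j) (2 * int n - int i - int j)"
proof -
  interpret layered_cut n p "2 * k" "layer 0 (2 * int p - 1)" using assms even_layers by simp
  obtain m where m: "i + j = 2 * m" using \<open>even (i + j)\<close> by (elim evenE)
  define r where "r = m - i"
  have "1 \<le> r" "r \<le> m" "m \<le> n - r" "m - r = i" "m + r + 0 = j"
    using m assms unfolding r_def by auto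
  then have "layer 0 (2 * int p - 1) r m \<longleftrightarrow> p \<le> min m (n - m)"
    using assms(1) unfolding columns_even_def cut_by_columns_def by blast
  then show ?thesis
    unfolding layer_def \<open>m - r = i\<close> \<open>m + r + 0 = j\<close> using m assms by (auto simp: min_def)
qed

lemma layers_even_iff:
  assumes "layers_even p" "p \<in> {1..2 * k}" "i < j" "j \<le> n" "even (i + j)"
  shows "2 * int p - 1 < h i j \<longleftrightarrow> 2 * int p - 1 < int j - int i"
proof -
  interpret layered_cut n p "2 * k" "layer 0 (2 * int p - 1)" using assms even_layers by simp
  obtain m where m: "i + j = 2 * m" using \<open>even (i + j)\<close> by (elim evenE)
  define r where "r = m - i"
  have "1 \<le> r" "r \<le> m" "m \<le> n - r" "m - r = i" "m + r + 0 = j"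
    using m assms unfolding r_def by auto
  then have "layer 0 (2 * int p - 1) r m \<longleftrightarrow> p \<le> r"
    using assms(1) unfolding layers_even_def cut_by_layers_def by blast
  then show ?thesis
    unfolding layer_def \<open>m - r = i\<close> \<open>m + r + 0 = j\<close> using m assms r_def by auto
qed

lemma columns_odd_iff:
  assumes "columns_odd p" "p \<in> {1..2 * k - 1}" "i < j" "j \<le> n" "odd (i + j)"
  shows "2 * int p < h i j \<longleftrightarrow> 2 * int p < min (int i + int j) (2 * int n - int i - int j)"
proof -
  interpret layered_cut "n - 1" p "2 * k - 1" "layer 1 (2 * int p)" using assms odd_layers by simp
  obtain m where m: "i + j = 2 * m + 1" using \<open>odd (i + j)\<close> by (elim oddE)
  define r where "r = m - i"
  have "0 \<le> r" "r \<le> m" "m \<le> n - 1 - r" "m - r = i" "m + r + 1 = j"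
    using m assms unfolding r_def by auto
  then have "layer 1 (2 * int p) r m \<longleftrightarrow> p \<le> min m (n - 1 - m)"
    using assms(1) unfolding columns_odd_def cut_by_columns_def by blast
  then show ?thesis
    unfolding layer_def \<open>m - r = i\<close> \<open>m + r + 1 = j\<close> using m assms by (auto simp: min_def)
qed

lemma layers_odd_iff:
  assumes "layers_odd p" "p \<in> {1..2 * k - 1}" "i < j" "j \<le> n" "odd (i + j)"
  shows "2 * int p < h i j \<longleftrightarrow> 2 * int p < int j - int i"
proof -
  interpret layered_cut "n - 1" p "2 * k - 1" "layer 1 (2 * int p)" using assms odd_layers by simp
  obtain m where m: "i + j = 2 * m + 1" using \<open>odd (i + j)\<close> by (elim oddE)
  define r where "r = m - i"
  have "0 \<le> r" "r \<le> m" "m \<le> n - 1 - r" "m - r = i" "m + r + 1 = j"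
    using m assms unfolding r_def by auto
  then have "layer 1 (2 * int p) r m \<longleftrightarrow> p \<le> r"
    using assms(1) unfolding layers_odd_def cut_by_layers_def by blast
  then show ?thesis
    unfolding layer_def \<open>m - r = i\<close> \<open>m + r + 1 = j\<close> using m assms r_def by auto
qed

end

text \<open>An even number in this range is twice the number of odd levels below it.\<close>

lemma even_eq_by_levels:
  fixes x y :: int
  assumes "even x" "even y" "0 \<le> x" "x \<le> 4 * int k" "0 \<le> y" "y \<le> 4 * int k"
    and "\<And>p. p \<in> {1..2 * k} \<Longrightarrow> 2 * int p - 1 < x \<longleftrightarrow> 2 * int p - 1 < y"
  shows "x = y"
proof -
  obtain a' b' where "x = 2 * a'" "y = 2 * b'" using assms by (elim evenE)
  moreover from this obtain a b where "a' = int a" "b' = int b"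
    using assms(3,5) zero_le_imp_eq_int[of a'] zero_le_imp_eq_int[of b'] by auto
  ultimately have ab: "x = 2 * int a" "y = 2 * int b" by auto
  have "a \<le> b" using assms(7)[of a] assms(3-6) ab by (cases "a = 0") auto
  moreover have "b \<le> a" using assms(7)[of b] assms(3-6) ab by (cases "b = 0") auto
  ultimately show ?thesis using ab by simp
qed

lemma odd_eq_by_levels:
  fixes x y :: int
  assumes "odd x" "odd y" "0 \<le> x" "x \<le> 4 * int k" "0 \<le> y" "y \<le> 4 * int k"
    and "\<And>p. p \<in> {1..2 * k - 1} \<Longrightarrow> 2 * int p < x \<longleftrightarrow> 2 * int p < y"
  shows "x = y"
proof -
  obtain a' b' where "x = 2 * a' + 1" "y = 2 * b' + 1" using assms by (elim oddE)
  moreover from this obtain a b where "a' = int a" "b' = int b"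
    using assms(3,5) zero_le_imp_eq_int[of a'] zero_le_imp_eq_int[of b'] by auto
  ultimately have ab: "x = 2 * int a + 1" "y = 2 * int b + 1" by auto
  have "a \<le> b" using assms(7)[of a] assms(3-6) ab by (cases "a = 0") auto
  moreover have "b \<le> a" using assms(7)[of b] assms(3-6) ab by (cases "b = 0") auto
  ultimately show ?thesis using ab by simp
qed

lemma less_profile_iff:
  assumes "i < j"
  shows "q < profile n ce co i j \<longleftrightarrow> q < int j - int i \<or>
    q < min (int i + int j) (2 * int n - int i - int j) \<and> q < (if even (i + j) then ce else co)"
  using assms by (auto simp: profile_def)

lemma profile_bounds:
  assumes "i < j" "j \<le> n"
  shows "0 \<le> profile n ce co i j" "profile n ce co i j \<le> int n"
proof -
  show "0 \<le> profile n ce co i j"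
    unfolding profile_def by (rule max.coboundedI1) simp
  have "min (int i + int j) (2 * int n - int i - int j) \<le> int n" by linarith
  note bound = max.boundedI[OF _ min.coboundedI1[OF this]]
  show "profile n ce co i j \<le> int n"
    unfolding profile_def by (rule bound) (use assms in linarith)
qed

lemma even_profile_iff:
  assumes "even ce" "odd co"
  shows "even (profile n ce co i j) \<longleftrightarrow> even (i + j)"
proof -
  have "profile n ce co i j \<in> {\<bar>int j - int i\<bar>, int i + int j, 2 * int n - int i - int j,
      if even (i + j) then ce else co}"
    unfolding profile_def max_def min_def by simp
  then show ?thesis using assms by (auto split: if_splits)
qed

context height_function
begin

lemma profile_bounds_four_k:
  assumes "i < j" "j \<le> n"
  shows "0 \<le> profile n ce co i j" "profile n ce co i j \<le> 4 * int k"
    "0 \<le> h i j" "h i j \<le> 4 * int k"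
  using profile_bounds[of i j n ce co] height_ge[of i j] height_le[of i j] height_le'[of i j] assms n
  by linarith+

text \<open>The cap is chosen so that exactly the levels cut by columns lie below it; only the tied
  level p = k + 1 is free, and \<open>ce\<close> records its choice.\<close>

lemma tight_profile_even:
  assumes "card zero_cells = 4 * k * k" "i < j" "j \<le> n" "even (i + j)" "odd co"
    and ce: "ce = (if columns_even (k + 1) then 2 * int k + 2 else 2 * int k)"
  shows "h i j = profile n ce co i j"
proof (rule even_eq_by_levels)
  show "even (h i j)" using assms even_height_iff[of i j] by simp
  have "even ce" using ce by simp
  then show "even (profile n ce co i j)" using assms(4,5) even_profile_iff by blast
  fix p assume p: "p \<in> {1..2 * k}"
  have prof: "2 * int p - 1 < profile n ce co i j \<longleftrightarrow> 2 * int p - 1 < int j - int i \<or>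
      2 * int p - 1 < min (int i + int j) (2 * int n - int i - int j) \<and> 2 * int p - 1 < ce"
    using less_profile_iff[OF assms(2)] assms(4) by simp
  show "2 * int p - 1 < h i j \<longleftrightarrow> 2 * int p - 1 < profile n ce co i j"
  proof (cases "p \<le> k \<or> p = k + 1 \<and> columns_even p")
    case True
    then have c: "columns_even p" using tight_levels(1)[OF assms(1) p] by auto
    have "2 * int p - 1 < ce" using True ce by auto
    \<comment> \<open>Above the diagonal j - i never exceeds i + j or 2n - i - j, so below the cap
      the alternative with j - i adds nothing.\<close>
    then show ?thesis
      unfolding prof columns_even_iff[OF c p assms(2-4)] using assms(2,3) by linarith
  next
    case False
    then have l: "layers_even p" using tight_levels(1)[OF assms(1) p] by (cases "p = k + 1") auto
    have "\<not> 2 * int p - 1 < ce" using False ce by (cases "p = k + 1") auto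
    then show ?thesis
      unfolding prof layers_even_iff[OF l p assms(2-4)] by blast
  qed
qed (use profile_bounds_four_k assms(2,3) in auto)

lemma tight_profile_odd:
  assumes "card zero_cells = 4 * k * k" "i < j" "j \<le> n" "odd (i + j)" "even ce"
    and co: "co = (if columns_odd k then 2 * int k + 1 else 2 * int k - 1)"
  shows "h i j = profile n ce co i j"
proof (rule odd_eq_by_levels)
  show "odd (h i j)" using assms even_height_iff[of i j] by simp
  have "odd co" using co by simp
  then show "odd (profile n ce co i j)" using assms(4,5) even_profile_iff by blast
  fix p assume p: "p \<in> {1..2 * k - 1}"
  have prof: "2 * int p < profile n ce co i j \<longleftrightarrow> 2 * int p < int j - int i \<or>
      2 * int p < min (int i + int j) (2 * int n - int i - int j) \<and> 2 * int p < co"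
    using less_profile_iff[OF assms(2)] assms(4) by simp
  show "2 * int p < h i j \<longleftrightarrow> 2 * int p < profile n ce co i j"
  proof (cases "p < k \<or> p = k \<and> columns_odd p")
    case True
    then have c: "columns_odd p" using tight_levels(2)[OF assms(1) p] by auto
    have "2 * int p < co" using True co by auto
    then show ?thesis
      unfolding prof columns_odd_iff[OF c p assms(2-4)] using assms(2,3) by linarith
  next
    case False
    then have l: "layers_odd p" using tight_levels(2)[OF assms(1) p] by (cases "p = k") auto
    have "\<not> 2 * int p < co" using False co by (cases "p = k") auto
    then show ?thesis
      unfolding prof layers_odd_iff[OF l p assms(2-4)] by blast
  qed
qed (use profile_bounds_four_k assms(2,3) in auto)

lemma tight_profile:
  assumes "card zero_cells = 4 * k * k"
  obtains ce co where
    "(ce, co) \<in> {(2 * int k, 2 * int k + 1), (2 * int k, 2 * int k - 1), (2 * int k + 2, 2 * int k + 1)}"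
    "\<And>i j. i < j \<Longrightarrow> j \<le> n \<Longrightarrow> h i j = profile n ce co i j"
proof -
  define ce co where "ce = (if columns_even (k + 1) then 2 * int k + 2 else 2 * int k)"
    and "co = (if columns_odd k then 2 * int k + 1 else 2 * int k - 1)"
  have par: "even ce" "odd co" by (simp_all add: ce_def co_def)
  have prof: "h i j = profile n ce co i j" if "i < j" "j \<le> n" for i j
    using tight_profile_even[OF assms that _ par(2) ce_def]
      tight_profile_odd[OF assms that _ par(1) co_def] by blast
  have "\<not> (ce = 2 * int k + 2 \<and> co = 2 * int k - 1)"
  proof
    assume c: "ce = 2 * int k + 2 \<and> co = 2 * int k - 1"
    \<comment> \<open>These adjacent corners expose the conflict: the caps would give them the
      heights 2k - 1 and 2k + 2.\<close>
    have "h k (k + 1) = profile n ce co k (k + 1)" "h k (k + 2) = profile n ce co k (k + 2)"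
      using n k by (intro prof; simp)+
    then have "h k (k + 1) \<le> 2 * int k" "h k (k + 2) = 2 * int k + 2"
      using c n k unfolding profile_def by (simp_all add: min_def max_def)
    moreover have "\<bar>h k (Suc (k + 1)) - h k (k + 1)\<bar> = 1" using n k by (intro horizontal) auto
    ultimately show False by simp
  qed
  then have "(ce, co) \<in> {(2 * int k, 2 * int k + 1), (2 * int k, 2 * int k - 1),
      (2 * int k + 2, 2 * int k + 1)}"
    unfolding ce_def co_def by (auto split: if_splits)
  with prof that show thesis by blast
qed

end

section \<open>Alternating sign matrices and their heights\<close>

text \<open>Here \<open>s\<close> is the sum of what has been read and \<open>2 * s - 1\<close> the
  last nonzero entry read: partial sums in {0, 1} mean that the sum is 1 after a +1 and 0 after a
  -1.\<close>

lemma alternating_iff_prefix_sums_aux: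
  fixes xs :: "int list"
  assumes "set xs \<subseteq> {0, 1, -1}" "s \<in> {0, 1}"
  shows "(\<forall>m\<le>length xs. s + sum_list (take m xs) \<in> {0, 1}) \<and> s + sum_list xs = 1 \<longleftrightarrow>
    last ((2 * s - 1) # filter (\<lambda>x. x \<noteq> 0) xs) = 1 \<and>
    successively (\<lambda>x y. sgn y = - sgn x) ((2 * s - 1) # filter (\<lambda>x. x \<noteq> 0) xs)"
  using assms
proof (induction xs arbitrary: s)
  case Nil
  then show ?case by auto
next
  case (Cons x xs)
  have all: "(\<forall>m\<le>length (x # xs). s + sum_list (take m (x # xs)) \<in> {0, 1}) \<longleftrightarrow>
      (\<forall>m\<le>length xs. (s + x) + sum_list (take m xs) \<in> {0, 1})" (is "?L \<longleftrightarrow> ?R")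
  proof
    assume ?L
    show ?R
    proof (intro allI impI)
      fix m assume "m \<le> length xs"
      with \<open>?L\<close>[rule_format, of "Suc m"] show "(s + x) + sum_list (take m xs) \<in> {0, 1}"
        by (simp add: add.assoc)
    qed
  next
    assume ?R
    show ?L
    proof (intro allI impI)
      fix m assume "m \<le> length (x # xs)"
      with \<open>?R\<close>[rule_format, of "m - 1"] Cons.prems(2)
      show "s + sum_list (take m (x # xs)) \<in> {0, 1}"
        by (cases m) (simp_all add: add.assoc)
    qed
  qed
  have step: "(\<forall>m\<le>length (x # xs). s + sum_list (take m (x # xs)) \<in> {0, 1})
      \<and> s + sum_list (x # xs) = 1 \<longleftrightarrow>
    (\<forall>m\<le>length xs. (s + x) + sum_list (take m xs) \<in> {0, 1}) \<and> (s + x) + sum_list xs = 1"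
    unfolding all by (simp add: add.assoc)
  show ?case
  proof (cases "s + x \<in> {0, 1}")
    case True
    have IH: "(\<forall>m\<le>length xs. (s + x) + sum_list (take m xs) \<in> {0, 1}) \<and> (s + x) + sum_list xs = 1
      \<longleftrightarrow> last ((2 * (s + x) - 1) # filter (\<lambda>x. x \<noteq> 0) xs) = 1 \<and>
        successively (\<lambda>x y. sgn y = - sgn x) ((2 * (s + x) - 1) # filter (\<lambda>x. x \<noteq> 0) xs)"
      by (rule Cons.IH) (use Cons.prems True in auto)
    have "x = 0 \<or> s = 0 \<and> x = 1 \<or> s = 1 \<and> x = -1" using True Cons.prems by auto
    then show ?thesis unfolding step IH by auto
  next
    case False
    then have "s = 0 \<and> x = -1 \<or> s = 1 \<and> x = 1" using Cons.prems by auto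
    moreover have "\<not> (\<forall>m\<le>length xs. (s + x) + sum_list (take m xs) \<in> {0, 1})"
      using False by force
    ultimately show ?thesis unfolding step by auto
  qed
qed

lemma alternating_iff_prefix_sums:
  assumes "set xs \<subseteq> {0, 1, -1}"
  shows "alternating_from_to_one xs \<longleftrightarrow>
    (\<forall>m\<le>length xs. sum_list (take m xs) \<in> {0, 1}) \<and> sum_list xs = 1"
proof -
  let ?ys = "filter (\<lambda>x. x \<noteq> 0) xs"
  have "hd ?ys = 1 \<longleftrightarrow> sgn (hd ?ys) = 1" if "?ys \<noteq> []"
  proof -
    have "hd ?ys \<in> {1, -1}" using hd_in_set[OF that] assms by auto
    then show ?thesis by auto
  qed
  \<comment> \<open>A fictitious leading -1 forces the first nonzero entry to be +1, and, as the
    last entry has to be 1, also that there is one.\<close>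
  then have "alternating_from_to_one xs \<longleftrightarrow>
      last ((2 * 0 - 1) # ?ys) = 1 \<and> successively (\<lambda>x y. sgn y = - sgn x) ((2 * 0 - 1) # ?ys)"
    by (cases ?ys) (auto simp: alternating_from_to_one_def Let_def)
  with alternating_iff_prefix_sums_aux[OF assms, of 0] show ?thesis by simp
qed

text \<open>Alternation is restated by partial sums because these are the differences of
  neighbouring heights, up to an affine change.\<close>

definition asm_entries :: "nat \<Rightarrow> (nat \<Rightarrow> nat \<Rightarrow> int) \<Rightarrow> bool" where
  "asm_entries n a \<longleftrightarrow> (\<forall>i<n. \<forall>j<n. a i j \<in> {0, 1, -1}) \<and>
     (\<forall>i<n. (\<forall>m\<le>n. (\<Sum>j<m. a i j) \<in> {0, 1}) \<and> (\<Sum>j<n. a i j) = 1) \<and>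
     (\<forall>j<n. (\<forall>m\<le>n. (\<Sum>i<m. a i j) \<in> {0, 1}) \<and> (\<Sum>i<n. a i j) = 1)"

lemma alternating_map_iff:
  assumes "\<forall>j<n. f j \<in> {0, 1, -1}"
  shows "alternating_from_to_one (map f [0..<n]) \<longleftrightarrow>
    (\<forall>m\<le>n. (\<Sum>j<m. f j) \<in> {0, 1}) \<and> (\<Sum>j<n. f j) = 1"
proof -
  have "sum_list (take m (map f [0..<n])) = (\<Sum>j<m. f j)" if "m \<le> n" for m
    using that by (simp add: take_map sum_list_distinct_conv_sum_set lessThan_atLeast0)
  moreover have "sum_list (map f [0..<n]) = (\<Sum>j<n. f j)"
    by (simp add: sum_list_distinct_conv_sum_set lessThan_atLeast0)
  moreover have "set (map f [0..<n]) \<subseteq> {0, 1, -1}" using assms by auto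
  ultimately show ?thesis using alternating_iff_prefix_sums[of "map f [0..<n]"] by simp
qed

lemma elements_mat_subset_iff:
  assumes "A \<in> carrier_mat n n"
  shows "elements_mat A \<subseteq> S \<longleftrightarrow> (\<forall>i<n. \<forall>j<n. A $$ (i, j) \<in> S)"
  using elements_matI[OF assms] elements_matD[of _ A] assms by (metis carrier_matD subset_iff)

lemma alternating_sign_matrix_iff:
  "alternating_sign_matrix n A \<longleftrightarrow>
     A \<in> carrier_mat n n \<and> asm_entries n (\<lambda>i j. A $$ (i, j))"
proof (cases "A \<in> carrier_mat n n")
  case True
  have rows: "list_of_vec (row A i) = map (\<lambda>j. A $$ (i, j)) [0..<n]" if "i < n" for i
    using True that by (intro nth_equalityI) (auto simp: list_of_vec_index)
  have cols: "list_of_vec (col A j) = map (\<lambda>i. A $$ (i, j)) [0..<n]" if "j < n" for j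
    using True that by (intro nth_equalityI) (auto simp: list_of_vec_index)
  show ?thesis
  proof (cases "\<forall>i<n. \<forall>j<n. A $$ (i, j) \<in> {0, 1, -1}")
    case entries: True
    have rows_iff: "(\<forall>i<n. alternating_from_to_one (list_of_vec (row A i))) \<longleftrightarrow>
        (\<forall>i<n. (\<forall>m\<le>n. (\<Sum>j<m. A $$ (i, j)) \<in> {0, 1}) \<and> (\<Sum>j<n. A $$ (i, j)) = 1)"
    proof (intro all_cong)
      fix i assume "i < n"
      then show "alternating_from_to_one (list_of_vec (row A i)) \<longleftrightarrow>
          (\<forall>m\<le>n. (\<Sum>j<m. A $$ (i, j)) \<in> {0, 1}) \<and> (\<Sum>j<n. A $$ (i, j)) = 1"
        unfolding rows[OF \<open>i < n\<close>] using entries by (intro alternating_map_iff) blast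
    qed
    have cols_iff: "(\<forall>j<n. alternating_from_to_one (list_of_vec (col A j))) \<longleftrightarrow>
        (\<forall>j<n. (\<forall>m\<le>n. (\<Sum>i<m. A $$ (i, j)) \<in> {0, 1}) \<and> (\<Sum>i<n. A $$ (i, j)) = 1)"
    proof (intro all_cong)
      fix j assume "j < n"
      then show "alternating_from_to_one (list_of_vec (col A j)) \<longleftrightarrow>
          (\<forall>m\<le>n. (\<Sum>i<m. A $$ (i, j)) \<in> {0, 1}) \<and> (\<Sum>i<n. A $$ (i, j)) = 1"
        unfolding cols[OF \<open>j < n\<close>] using entries by (intro alternating_map_iff) blast
    qed
    show ?thesis
      unfolding alternating_sign_matrix_def asm_entries_def elements_mat_subset_iff[OF True]
        rows_iff cols_iff ..
  next
    case False
    then show ?thesis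
      unfolding alternating_sign_matrix_def asm_entries_def elements_mat_subset_iff[OF True] by blast
  qed
qed (simp add: alternating_sign_matrix_def)

definition height :: "(nat \<Rightarrow> nat \<Rightarrow> int) \<Rightarrow> nat \<Rightarrow> nat \<Rightarrow> int" where
  "height a i j = int i + int j - 2 * (\<Sum>x<i. \<Sum>y<j. a x y)"

lemma height_Suc_row: "height a (Suc i) j = height a i j + 1 - 2 * (\<Sum>y<j. a i y)"
  by (simp add: height_def)

lemma height_Suc_col: "height a i (Suc j) = height a i j + 1 - 2 * (\<Sum>x<i. a x j)"
  by (simp add: height_def sum.distrib)

lemma height_entry:
  "2 * a i j = height a i (Suc j) + height a (Suc i) j - height a i j - height a (Suc i) (Suc j)"
  by (simp add: height_Suc_row)

lemma height_sym:
  assumes "\<And>i j. i < n \<Longrightarrow> j < n \<Longrightarrow> a i j = a j i" "i \<le> n" "j \<le> n"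
  shows "height a i j = height a j i"
proof -
  have "(\<Sum>x<i. \<Sum>y<j. a x y) = (\<Sum>x<i. \<Sum>y<j. a y x)"
    using assms by (intro sum.cong) auto
  also have "\<dots> = (\<Sum>x<j. \<Sum>y<i. a x y)" by (rule sum.swap)
  finally show ?thesis by (simp add: height_def)
qed

lemma height_function_height:
  assumes "asm_entries n a" "\<And>i j. i < n \<Longrightarrow> j < n \<Longrightarrow> a i j = a j i" "\<And>i. i < n \<Longrightarrow> a i i = 0"
    and "n = 4 * k" "1 \<le> k"
  shows "height_function n k (height a)"
proof
  show "height a i n = int n - int i" if "i \<le> n" for i
  proof -
    have "(\<Sum>x<i. \<Sum>y<n. a x y) = (\<Sum>x<i. 1)"
      using assms(1) that by (intro sum.cong) (auto simp: asm_entries_def)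
    then show ?thesis by (simp add: height_def)
  qed
  show "\<bar>height a i (Suc j) - height a i j\<bar> = 1" if "i \<le> j" "j < n" for i j
  proof -
    have "(\<Sum>x<i. a x j) \<in> {0, 1}" using assms(1) that by (auto simp: asm_entries_def)
    then show ?thesis by (auto simp: height_Suc_col)
  qed
  show "\<bar>height a (Suc i) j - height a i j\<bar> = 1" if "i < j" "j \<le> n" for i j
  proof -
    have "(\<Sum>y<j. a i y) \<in> {0, 1}" using assms(1) that by (auto simp: asm_entries_def)
    then show ?thesis by (auto simp: height_Suc_row)
  qed
  show "height a i i + height a (Suc i) (Suc i) = 2 * height a i (Suc i)" if "i < n" for i
    using height_entry[of a i i] height_sym[of n a i "Suc i"] assms(2,3) that by simp
qed (use assms in \<open>auto simp: height_def\<close>)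

text \<open>Summing the entries of a row telescopes to half of 1 minus a vertical step of
  \<open>H\<close>, which is 0 or 1 because steps are 1 or -1. Columns follow by symmetry.\<close>

lemma asm_entries_of_height:
  assumes entry: "\<And>i j. i < n \<Longrightarrow> j < n \<Longrightarrow>
      2 * a i j = H i (Suc j) + H (Suc i) j - H i j - H (Suc i) (Suc j)"
    and sym: "\<And>i j. H i j = H j i"
    and top: "\<And>j. j \<le> n \<Longrightarrow> H 0 j = int j"
    and right: "\<And>i. i \<le> n \<Longrightarrow> H i n = int n - int i"
    and step: "\<And>i j. i \<le> n \<Longrightarrow> j < n \<Longrightarrow> \<bar>H i (Suc j) - H i j\<bar> = 1"
  shows "asm_entries n a"
proof -
  have step': "\<bar>H (Suc i) j - H i j\<bar> = 1" if "i < n" "j \<le> n" for i j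
    using step[of j i] sym that by simp
  have row: "2 * (\<Sum>j<m. a i j) = 1 - (H (Suc i) m - H i m)" if "i < n" "m \<le> n" for i m
    using that(2)
  proof (induction m)
    case 0
    have "H i 0 = int i" "H (Suc i) 0 = int (Suc i)"
      using top[of i] top[of "Suc i"] sym[of i 0] sym[of "Suc i" 0] that(1) by auto
    then show ?case by simp
  next
    case (Suc m)
    then show ?case using entry[of i m] that(1) by simp
  qed
  have a_sym: "a i j = a j i" if "i < n" "j < n" for i j
    using entry[of i j] entry[of j i] sym[of i j] sym[of i "Suc j"] sym[of "Suc i" j]
      sym[of "Suc i" "Suc j"] that by simp
  have R: "(\<Sum>j<m. a i j) \<in> {0, 1}" if "i < n" "m \<le> n" for i m
    using row[OF that] step'[OF that] by (auto simp: abs_if split: if_splits)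
  have total: "(\<Sum>j<n. a i j) = 1" if "i < n" for i
    using row[OF that le_refl] right[of i] right[of "Suc i"] that by simp
  have cols: "(\<Sum>i<m. a i j) = (\<Sum>i<m. a j i)" if "j < n" "m \<le> n" for j m
    using that by (intro sum.cong a_sym) auto
  have "a i j \<in> {0, 1, -1}" if "i < n" "j < n" for i j
  proof -
    have "x - y \<in> {0, 1, -1}" if "x \<in> {0, 1}" "y \<in> {0, 1}" for x y :: int using that by auto
    from this[OF R[of i "Suc j"] R[of i j]] that show ?thesis by simp
  qed
  then show ?thesis using R total cols unfolding asm_entries_def by simp
qed

section \<open>Nonzero entries and zero cells above the diagonal\<close>

lemma card_pairs_less: "2 * card {(i, j). i < j \<and> j < n} = n * (n - 1)" for n :: nat
proof -
  have "{(i, j). i < j \<and> j < n} = prod.swap ` (SIGMA j : {..<n}. {..<j})" by auto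
  then have "card {(i, j). i < j \<and> j < n} = card (SIGMA j : {..<n}. {..<j})"
    by (simp add: card_image)
  also have "\<dots> = \<Sum>{..<n}" by simp
  also have "2 * \<dots> = n * (n - 1)"
  proof (induction n)
    case (Suc n)
    then show ?case by (cases n) (simp_all add: lessThan_Suc algebra_simps)
  qed simp
  finally show ?thesis .
qed

lemma finite_pairs_less: "finite {(i, j). i < j \<and> j < n}" for n :: nat
  by (rule finite_subset[of _ "{..<n} \<times> {..<n}"]) auto

lemma num_nonzero_upper:
  assumes "hollow_symmetric_asm n A"
  shows "num_nonzero A = 2 * card {(i, j). i < j \<and> j < n \<and> A $$ (i, j) \<noteq> 0}"
proof -
  define a where "a = (\<lambda>i j. A $$ (i, j))"
  have A: "A \<in> carrier_mat n n" "\<And>i. i < n \<Longrightarrow> a i i = 0"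
    using assms unfolding hollow_symmetric_asm_def alternating_sign_matrix_iff a_def by auto
  have sym: "a i j = a j i" if "i < n" "j < n" for i j
    using assms A(1) that unfolding hollow_symmetric_asm_def a_def
    by (metis carrier_matD index_transpose_mat(1))
  let ?U = "{(i, j). i < j \<and> j < n \<and> a i j \<noteq> 0}"
  have fin: "finite ?U" by (rule finite_subset[OF _ finite_pairs_less[of n]]) auto
  have "{(i, j). i < dim_row A \<and> j < dim_col A \<and> A $$ (i, j) \<noteq> 0} = ?U \<union> prod.swap ` ?U"
  proof (rule Set.set_eqI)
    fix x :: "nat \<times> nat"
    obtain i j where x: "x = (i, j)" by force
    have "(i, j) \<in> prod.swap ` ?U \<longleftrightarrow> (j, i) \<in> ?U" by force
    moreover have "a j i = a i j" if "i < n" "j < n" using sym that by simp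
    moreover have "dim_row A = n" "dim_col A = n" using A(1) by auto
    ultimately show "x \<in> {(i, j). i < dim_row A \<and> j < dim_col A \<and> A $$ (i, j) \<noteq> 0} \<longleftrightarrow>
        x \<in> ?U \<union> prod.swap ` ?U"
      using A(2)[of i] unfolding x a_def[symmetric]
      by (cases i j rule: linorder_cases) (auto simp: a_def)
  qed
  moreover have "?U \<inter> prod.swap ` ?U = {}" by auto
  ultimately show ?thesis
    using fin by (simp add: num_nonzero_def card_Un_disjoint card_image a_def)
qed

lemma num_nonzero_eq:
  assumes "hollow_symmetric_asm n A" "n = 4 * k" "1 \<le> k"
  shows "num_nonzero A + 2 * card (height_function.zero_cells n (height (\<lambda>i j. A $$ (i, j)))) = n * (n - 1)"
proof -
  define a where "a = (\<lambda>i j. A $$ (i, j))"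
  have A: "A \<in> carrier_mat n n" "asm_entries n a" "\<And>i. i < n \<Longrightarrow> a i i = 0"
    using assms(1) unfolding hollow_symmetric_asm_def alternating_sign_matrix_iff a_def by auto
  have sym: "a i j = a j i" if "i < n" "j < n" for i j
    using assms(1) A(1) that unfolding hollow_symmetric_asm_def a_def
    by (metis carrier_matD index_transpose_mat(1))
  interpret height_function n k "height a"
    using height_function_height A sym assms(2,3) by blast
  let ?U = "{(i, j). i < j \<and> j < n \<and> a i j \<noteq> 0}"
  have zero: "(i, j) \<in> zero_cells \<longleftrightarrow> a i j = 0" if "i < j" "j < n" for i j
  proof -
    have "\<bar>height a i (Suc j) - height a i j\<bar> = 1" "\<bar>height a (Suc i) (Suc j) - height a (Suc i) j\<bar> = 1"
      "\<bar>height a (Suc i) j - height a i j\<bar> = 1" "\<bar>height a (Suc i) (Suc j) - height a i (Suc j)\<bar> = 1"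
      using that by (auto intro!: horizontal vertical)
    then show ?thesis using that height_entry[of a i j] unfolding zero_cells_def by auto
  qed
  have split: "{(i, j). i < j \<and> j < n} = ?U \<union> zero_cells"
  proof (rule Set.set_eqI)
    fix x :: "nat \<times> nat"
    show "x \<in> {(i, j). i < j \<and> j < n} \<longleftrightarrow> x \<in> ?U \<union> zero_cells"
      using zero[of "fst x" "snd x"] by (cases x) (auto simp: zero_cells_def)
  qed
  have fin: "finite ?U" by (rule finite_subset[OF _ finite_pairs_less[of n]]) auto
  have "?U \<inter> zero_cells = {}" using zero by blast
  with card_Un_disjoint[OF fin finite_zero_cells]
  have "card {(i, j). i < j \<and> j < n} = card ?U + card zero_cells" unfolding split by blast
  moreover have "num_nonzero A = 2 * card ?U"
    using num_nonzero_upper[OF assms(1)] by (simp add: a_def)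
  ultimately show ?thesis using card_pairs_less[of n] unfolding a_def by simp
qed

section \<open>Extremal heights\<close>

text \<open>The profile in the rotated coordinates s = i + j and d = j - i. The four lemmas that
  follow describe the regions on which it is linear.\<close>

definition capped :: "int \<Rightarrow> int \<Rightarrow> int \<Rightarrow> int \<Rightarrow> int" where
  "capped n s d c = max d (min (min s (2 * n - s)) c)"

lemma capped_wide: "c \<le> d \<Longrightarrow> capped n s d c = d"
  by (simp add: capped_def max_def min_def)

lemma capped_low: "s \<le> c \<Longrightarrow> s \<le> n \<Longrightarrow> d \<le> s \<Longrightarrow> capped n s d c = s"
  by (simp add: capped_def max_def min_def)

lemma capped_high: "2 * n - s \<le> c \<Longrightarrow> n \<le> s \<Longrightarrow> d \<le> 2 * n - s \<Longrightarrow> capped n s d c = 2 * n - s"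
  by (simp add: capped_def max_def min_def)

lemma capped_mid: "d \<le> c \<Longrightarrow> c \<le> s \<Longrightarrow> c \<le> 2 * n - s \<Longrightarrow> capped n s d c = c"
  by (simp add: capped_def max_def min_def)

text \<open>
  Two opposite corners of a cell lie in one sublattice, with cap \<open>x\<close>, and the other two in the other
  one, with cap \<open>y\<close>; the cell is nonzero exactly where both caps are attained.
\<close>

lemma capped_cell:
  assumes "e \<in> {1, -1}" "y = x + e" "1 \<le> d" "d \<le> s" "d \<le> 2 * n - s - 2" "x \<le> n" "y \<le> n"
    and "even (s + x)" "even (d + x)"
  shows "capped n (s + 1) (d + 1) y + capped n (s + 1) (d - 1) y - capped n s d x - capped n (s + 2) d x
     = (if 2 * d < 2 * x + e \<and> x \<le> s \<and> s + 2 \<le> 2 * n - x then 2 * e else 0)"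
proof -
  \<comment> \<open>Parity rules out the positions at which the corners of the cell would fall into
    different linear regions.\<close>
  have par: "s \<noteq> x - 1" "s \<noteq> 2 * n - x - 1" "d \<noteq> x - 1" "d \<noteq> x + 1" using assms(8,9) by auto
  have e: "e = 1 \<or> e = -1" using assms(1) by simp
  \<comment> \<open>On the boundary d = x the sign decides: the corner at d + 1 stays under its cap
    y exactly if y = x + 1.\<close>
  consider (wide) "x < d \<or> x = d \<and> e = -1" | (low) "s < x" "d \<le> x"
    | (high) "2 * n - x < s + 2" "d \<le> x" "x \<le> s"
    | (mid) "x \<le> s" "s + 2 \<le> 2 * n - x" "d \<le> x" "x \<noteq> d \<or> e = 1"
    using e by linarith
  then show ?thesis
  proof cases
    case wide
    then have w: "y \<le> d - 1" "x \<le> d" using par e assms(2) by auto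
    then have "y \<le> d + 1" by simp
    moreover have "\<not> 2 * d < 2 * x + e" using wide e by auto
    ultimately show ?thesis using w by (simp add: capped_wide)
  next
    case low
    then have "s + 2 \<le> x" "s + 1 \<le> y" using par e assms(2) by auto
    then show ?thesis using low assms(3-7) by (simp add: capped_low)
  next
    case high
    then have "2 * n - s \<le> x" "2 * n - (s + 1) \<le> y" using par e assms(2) by auto
    then show ?thesis using high assms(3-7) by (simp add: capped_high)
  next
    case mid
    then have "d + 1 \<le> y" "y \<le> s + 1" "y \<le> 2 * n - (s + 1)" using par e assms(2) by auto
    moreover have "2 * d < 2 * x + e" using mid e by auto
    ultimately show ?thesis using mid assms(2) by (simp add: capped_mid)
  qed
qed

section \<open>Mixed differences of the profile over a cell\<close>

lemma capped_cong: "s = s' \<Longrightarrow> d = d' \<Longrightarrow> c = c' \<Longrightarrow> capped n s d c = capped n s' d' c'"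
  by simp

lemma profile_eq_capped:
  "profile n x y i j = capped (int n) (int i + int j) \<bar>int j - int i\<bar> (if even (i + j) then x else y)"
  by (simp add: profile_def capped_def diff_diff_eq)

text \<open>The cap at the corner (i, j) is \<open>c\<close> and that at its two neighbours in the
  cell is \<open>c + e'\<close>. On cells with i + j odd the two caps trade places, which reverses
  the sign.\<close>

lemma profile_cell:
  assumes "i < j" "j < n" "even x" "odd y" "e \<in> {1, -1}" "y = x + e" "x \<le> int n" "y \<le> int n"
    and c: "c = (if even (i + j) then x else y)" and e': "e' = (if even (i + j) then e else - e)"
  shows "profile n x y i (Suc j) + profile n x y (Suc i) j - profile n x y i j - profile n x y (Suc i) (Suc j)
    = (if 2 * (int j - int i) < 2 * c + e' \<and> c \<le> int i + int j \<and> int i + int j + 2 \<le> 2 * int n - c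
       then 2 * e' else 0)"
proof -
  let ?s = "int i + int j" and ?d = "int j - int i"
  have "profile n x y i (Suc j) = capped (int n) (?s + 1) (?d + 1) (c + e')"
    unfolding profile_eq_capped using assms by (intro capped_cong) auto
  moreover have "profile n x y (Suc i) j = capped (int n) (?s + 1) (?d - 1) (c + e')"
    unfolding profile_eq_capped using assms by (intro capped_cong) auto
  moreover have "profile n x y i j = capped (int n) ?s ?d c"
    unfolding profile_eq_capped using assms by (intro capped_cong) auto
  moreover have "profile n x y (Suc i) (Suc j) = capped (int n) (?s + 2) ?d c"
    unfolding profile_eq_capped using assms by (intro capped_cong) auto
  moreover have "capped (int n) (?s + 1) (?d + 1) (c + e') + capped (int n) (?s + 1) (?d - 1) (c + e')
      - capped (int n) ?s ?d c - capped (int n) (?s + 2) ?d c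
    = (if 2 * ?d < 2 * c + e' \<and> c \<le> ?s \<and> ?s + 2 \<le> 2 * int n - c then 2 * e' else 0)"
    by (rule capped_cell) (use assms in auto)
  ultimately show ?thesis by simp
qed

section \<open>Unit steps and the correction on the diagonal\<close>

lemma max_lipschitz: "\<bar>a - a'\<bar> \<le> 1 \<Longrightarrow> \<bar>b - b'\<bar> \<le> 1 \<Longrightarrow> \<bar>max a b - max a' b'\<bar> \<le> (1::int)"
  by linarith

lemma min_lipschitz: "\<bar>a - a'\<bar> \<le> 1 \<Longrightarrow> \<bar>b - b'\<bar> \<le> 1 \<Longrightarrow> \<bar>min a b - min a' b'\<bar> \<le> (1::int)"
  by linarith

lemma profile_sym: "profile n x y i j = profile n x y j i"
  by (simp add: profile_def abs_minus_commute add.commute algebra_simps)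

text \<open>The formula by itself only bounds a step by 1; parity excludes a step of 0.\<close>

lemma profile_step:
  assumes "even x" "odd y" "\<bar>x - y\<bar> \<le> 1"
  shows "\<bar>profile n x y i (Suc j) - profile n x y i j\<bar> = 1"
proof -
  have "\<bar>profile n x y i (Suc j) - profile n x y i j\<bar> \<le> 1"
    unfolding profile_def by (intro max_lipschitz min_lipschitz) (use assms(3) in auto)
  moreover have "odd (profile n x y i (Suc j) - profile n x y i j)"
    using assms(1,2) by (simp add: even_profile_iff)
  ultimately show ?thesis by (cases "profile n x y i (Suc j) = profile n x y i j") auto
qed

text \<open>The solution, starting from 0, of the relation that zero diagonal entries impose:
  consecutive diagonal heights average to the height at (i, i + 1). For k \<le> i < 3k that height
  is constantly \<open>y\<close>, so the solution is reflected in \<open>y\<close> at every step,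
  from 2k to 2y - 2k and back.\<close>

definition diagonal_profile :: "nat \<Rightarrow> int \<Rightarrow> nat \<Rightarrow> int" where
  "diagonal_profile k y i =
     (if i \<le> k then 2 * int i else if 3 * k \<le> i then 8 * int k - 2 * int i
      else if even (i + k) then 2 * int k else 2 * y - 2 * int k)"

definition hollow_profile :: "nat \<Rightarrow> int \<Rightarrow> int \<Rightarrow> nat \<Rightarrow> nat \<Rightarrow> int" where
  "hollow_profile k x y i j = (if i = j then diagonal_profile k y i else profile (4 * k) x y i j)"

lemma hollow_profile_sym: "hollow_profile k x y i j = hollow_profile k x y j i"
  by (simp add: hollow_profile_def profile_sym)

text \<open>The consistent choices at the two tied levels; in this order they belong to D, D' and
  E.\<close>

definition extremal_caps :: "nat \<Rightarrow> int \<Rightarrow> int \<Rightarrow> bool" where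
  "extremal_caps k x y \<longleftrightarrow> 1 \<le> k \<and>
     (x, y) \<in> {(2 * int k, 2 * int k + 1), (2 * int k, 2 * int k - 1), (2 * int k + 2, 2 * int k + 1)}"

lemma profile_next_diagonal:
  assumes "extremal_caps k x y" "i < 4 * k"
  shows "profile (4 * k) x y i (Suc i)
    = (if i < k then 2 * int i + 1 else if i < 3 * k then y else 8 * int k - 2 * int i - 1)"
proof -
  have y: "2 * int k - 1 \<le> y" "y \<le> 2 * int k + 1" "1 \<le> k" using assms(1) by (auto simp: extremal_caps_def)
  have p: "profile (4 * k) x y i (Suc i)
      = max 1 (min (min (2 * int i + 1) (8 * int k - 2 * int i - 1)) y)"
    by (simp add: profile_def)
  consider "i < k" | "k \<le> i" "i < 3 * k" | "3 * k \<le> i" by linarith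
  then show ?thesis
  proof cases
    case 1
    then have "2 * int i + 1 \<le> y" "2 * int i + 1 \<le> 8 * int k - 2 * int i - 1" using y by linarith+
    with 1 show ?thesis unfolding p by simp
  next
    case 2
    then have "y \<le> 2 * int i + 1" "y \<le> 8 * int k - 2 * int i - 1" "1 \<le> y" using y by linarith+
    with 2 show ?thesis unfolding p by simp
  next
    case 3
    then have "8 * int k - 2 * int i - 1 \<le> y" "8 * int k - 2 * int i - 1 \<le> 2 * int i + 1"
      "1 \<le> 8 * int k - 2 * int i - 1" using y assms(2) by linarith+
    with 3 y(3) show ?thesis unfolding p by simp
  qed
qed

lemma diagonal_profile_sum:
  assumes "extremal_caps k x y" "i < 4 * k"
  shows "diagonal_profile k y i + diagonal_profile k y (Suc i) = 2 * profile (4 * k) x y i (Suc i)"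
proof -
  have "1 \<le> k" using assms(1) by (simp add: extremal_caps_def)
  consider "i < k" | "i = k" | "k < i" "Suc i < 3 * k" | "Suc i = 3 * k" "k < i" | "3 * k \<le> i" by linarith
  then show ?thesis
  proof cases
    case 4
    then have "odd (i + k)" by presburger
    with 4 show ?thesis
      unfolding profile_next_diagonal[OF assms] by (simp add: diagonal_profile_def)
  qed (use \<open>1 \<le> k\<close> assms(2) in
      \<open>auto simp: diagonal_profile_def profile_next_diagonal[OF assms(1)]\<close>)
qed

lemma hollow_profile_step:
  assumes "extremal_caps k x y" "i \<le> 4 * k" "j < 4 * k"
  shows "\<bar>hollow_profile k x y i (Suc j) - hollow_profile k x y i j\<bar> = 1"
proof -
  have diag: "\<bar>profile (4 * k) x y m (Suc m) - diagonal_profile k y m\<bar> = 1" if "m < 4 * k" for m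
  proof -
    have "1 \<le> k" "\<bar>y - 2 * int k\<bar> = 1" using assms(1) by (auto simp: extremal_caps_def)
    then show ?thesis unfolding profile_next_diagonal[OF assms(1) that]
      by (auto simp: diagonal_profile_def)
  qed
  have step: "\<bar>profile (4 * k) x y i (Suc j) - profile (4 * k) x y i j\<bar> = 1"
    by (rule profile_step) (use assms(1) in \<open>auto simp: extremal_caps_def\<close>)
  consider "i = j" | "i = Suc j" | "i \<noteq> j" "i \<noteq> Suc j" by blast
  then show ?thesis
  proof cases
    case 1
    with diag[of j] assms(3) show ?thesis by (simp add: hollow_profile_def)
  next
    case 2
    \<comment> \<open>The height beside the diagonal is the mean of the two diagonal heights next to
      it, hence equally far from both.\<close>
    have "\<bar>diagonal_profile k y (Suc j) - profile (4 * k) x y (Suc j) j\<bar> = 1"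
      using diag[of j] diagonal_profile_sum[OF assms(1,3)] assms(3) profile_sym[of _ x y "Suc j" j]
      by simp
    with 2 show ?thesis by (simp add: hollow_profile_def)
  next
    case 3
    with step show ?thesis by (simp add: hollow_profile_def)
  qed
qed

text \<open>Symmetry and the zero diagonal supply the entries that are not prescribed, so the caps
  determine the matrix.\<close>

definition fits_profile :: "nat \<Rightarrow> int \<Rightarrow> int \<Rightarrow> int mat \<Rightarrow> bool" where
  "fits_profile k x y A \<longleftrightarrow> A \<in> carrier_mat (4 * k) (4 * k) \<and>
     (\<forall>i<4 * k. A $$ (i, i) = 0) \<and> (\<forall>i<4 * k. \<forall>j<4 * k. A $$ (i, j) = A $$ (j, i)) \<and>
     (\<forall>j<4 * k. \<forall>i<j. 2 * A $$ (i, j) = hollow_profile k x y i (Suc j) + hollow_profile k x y (Suc i) j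
        - hollow_profile k x y i j - hollow_profile k x y (Suc i) (Suc j))"

lemma hollow_symmetric_asm_if_fits_profile:
  assumes "extremal_caps k x y" "fits_profile k x y A"
  shows "hollow_symmetric_asm (4 * k) A"
proof -
  let ?H = "hollow_profile k x y"
  have k: "1 \<le> k" and y: "2 * int k - 1 \<le> y" "y \<le> 2 * int k + 1" and x: "2 * int k \<le> x" "x \<le> 2 * int k + 2"
    using assms(1) by (auto simp: extremal_caps_def)
  have A: "A \<in> carrier_mat (4 * k) (4 * k)" "\<And>i. i < 4 * k \<Longrightarrow> A $$ (i, i) = 0"
    "\<And>i j. i < 4 * k \<Longrightarrow> j < 4 * k \<Longrightarrow> A $$ (i, j) = A $$ (j, i)"
    "\<And>i j. i < j \<Longrightarrow> j < 4 * k \<Longrightarrow>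
      2 * A $$ (i, j) = ?H i (Suc j) + ?H (Suc i) j - ?H i j - ?H (Suc i) (Suc j)"
    using assms(2) by (auto simp: fits_profile_def)
  have "asm_entries (4 * k) (\<lambda>i j. A $$ (i, j))"
  proof (rule asm_entries_of_height[where H = ?H])
    fix i j assume ij: "i < 4 * k" "j < 4 * k"
    show "2 * A $$ (i, j) = ?H i (Suc j) + ?H (Suc i) j - ?H i j - ?H (Suc i) (Suc j)"
    proof (cases i j rule: linorder_cases)
      case less
      then show ?thesis using A(4) ij by simp
    next
      case equal
      have "?H (Suc j) j = ?H j (Suc j)" by (rule hollow_profile_sym)
      then show ?thesis using A(2)[of j] diagonal_profile_sum[OF assms(1) ij(2)] equal ij
        by (simp add: hollow_profile_def)
    next
      case greater
      have "2 * A $$ (j, i) = ?H j (Suc i) + ?H (Suc j) i - ?H j i - ?H (Suc j) (Suc i)"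
        using A(4) greater ij by simp
      then show ?thesis
        using A(3)[OF ij] hollow_profile_sym[of k x y j "Suc i"] hollow_profile_sym[of k x y "Suc j" i]
          hollow_profile_sym[of k x y j i] hollow_profile_sym[of k x y "Suc j" "Suc i"] by simp
    qed
  next
    fix j assume j: "j \<le> 4 * k"
    show "?H 0 j = int j"
      using j k x y by (cases "j = 0") (auto simp: hollow_profile_def profile_def diagonal_profile_def)
    have "profile (4 * k) x y j (4 * k) = 4 * int k - int j"
      using j by (auto simp: profile_def)
    then show "?H j (4 * k) = int (4 * k) - int j"
      using k by (auto simp: hollow_profile_def diagonal_profile_def)
  qed (use hollow_profile_sym hollow_profile_step[OF assms(1)] in auto)
  moreover have "transpose_mat A = A" using A(1,3) by (intro eq_matI) auto
  ultimately show ?thesis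
    using A(1,2) by (simp add: hollow_symmetric_asm_def alternating_sign_matrix_iff)
qed

lemma tight_fits_profile:
  assumes "hollow_symmetric_asm n A" "n = 4 * k" "1 \<le> k"
    and tight: "card (height_function.zero_cells n (height (\<lambda>i j. A $$ (i, j)))) = 4 * k * k"
  obtains x y where "extremal_caps k x y" "fits_profile k x y A"
proof -
  define a where "a = (\<lambda>i j. A $$ (i, j))"
  have A: "A \<in> carrier_mat n n" "asm_entries n a" "\<And>i. i < n \<Longrightarrow> a i i = 0"
    using assms(1) unfolding hollow_symmetric_asm_def alternating_sign_matrix_iff a_def by auto
  have sym: "a i j = a j i" if "i < n" "j < n" for i j
    using assms(1) A(1) that unfolding hollow_symmetric_asm_def a_def
    by (metis carrier_matD index_transpose_mat(1))
  interpret height_function n k "height a"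
    using height_function_height A sym assms(2,3) by blast
  obtain x y where
    xy: "(x, y) \<in> {(2 * int k, 2 * int k + 1), (2 * int k, 2 * int k - 1), (2 * int k + 2, 2 * int k + 1)}"
    and prof: "\<And>i j. i < j \<Longrightarrow> j \<le> n \<Longrightarrow> height a i j = profile n x y i j"
    using tight_profile tight unfolding a_def by metis
  have caps: "extremal_caps k x y" using xy assms(3) unfolding extremal_caps_def by blast
  \<comment> \<open>\<open>tight_profile\<close> is silent on the diagonal; there the zero entries
    propagate the heights from the corner (0, 0).\<close>
  have diag: "height a i i = diagonal_profile k y i" if "i \<le> n" for i
    using that
  proof (induction i)
    case 0
    then show ?case by (simp add: height_def diagonal_profile_def)
  next
    case (Suc i)
    have "height a i i + height a (Suc i) (Suc i) = 2 * height a i (Suc i)"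
      using Suc.prems by (intro diagonal) simp
    also have "height a i (Suc i) = profile (4 * k) x y i (Suc i)"
      using prof[of i "Suc i"] Suc.prems assms(2) by simp
    finally show ?case
      using diagonal_profile_sum[OF caps, of i] Suc assms(2) by simp
  qed
  have full: "height a i j = hollow_profile k x y i j" if "i \<le> j" "j \<le> n" for i j
    using diag[of i] prof[of i j] that assms(2) by (cases "i = j") (simp_all add: hollow_profile_def)
  have "2 * a i j = hollow_profile k x y i (Suc j) + hollow_profile k x y (Suc i) j
        - hollow_profile k x y i j - hollow_profile k x y (Suc i) (Suc j)" if "i < j" "j < n" for i j
    using that by (simp add: height_entry[of a i j] full)
  then have "fits_profile k x y A"
    unfolding fits_profile_def assms(2)[symmetric] using A(1,3) sym unfolding a_def by blast
  with caps that show thesis by blast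
qed

lemma fits_profile_unique:
  assumes "fits_profile k x y A" "fits_profile k x y B"
  shows "A = B"
proof (rule eq_matI)
  show "dim_row A = dim_row B" "dim_col A = dim_col B" using assms by (auto simp: fits_profile_def)
  fix i j assume "i < dim_row B" "j < dim_col B"
  then have ij: "i < 4 * k" "j < 4 * k" using assms(2) by (auto simp: fits_profile_def)
  have less: "A $$ (i, j) = B $$ (i, j)" if "i < j" "j < 4 * k" for i j
  proof -
    have "2 * A $$ (i, j) = 2 * B $$ (i, j)" using assms that unfolding fits_profile_def by metis
    then show ?thesis by simp
  qed
  show "A $$ (i, j) = B $$ (i, j)"
  proof (cases i j rule: linorder_cases)
    case less
    then show ?thesis using \<open>\<And>j i. \<lbrakk>i < j; j < 4 * k\<rbrakk> \<Longrightarrow> A $$ (i, j) = B $$ (i, j)\<close> ij by blast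
  next
    case equal
    then show ?thesis using assms ij unfolding fits_profile_def by metis
  next
    case greater
    then have "A $$ (j, i) = B $$ (j, i)" using less ij by blast
    then show ?thesis using assms ij unfolding fits_profile_def by metis
  qed
qed

section \<open>The hollowed matrices\<close>

lemma profile_diagonal:
  assumes "2 * int k \<le> x" "x \<le> 2 * int k + 2" "even x" "i \<le> 4 * k"
  shows "profile (4 * k) x y i i
    = (if i \<le> k then 2 * int i else if 3 * k \<le> i then 8 * int k - 2 * int i else x)"
proof -
  have p: "profile (4 * k) x y i i = capped (4 * int k) (2 * int i) 0 x"
    by (simp add: profile_eq_capped)
  have x: "x \<noteq> 2 * int k + 1" using assms(3) by auto
  consider "i \<le> k" | "k < i" "i < 3 * k" | "3 * k \<le> i" "k < i" | "i = 0" by linarith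
  then show ?thesis unfolding p
    by cases (use assms x in \<open>auto simp: capped_low capped_mid capped_high\<close>)
qed

text \<open>A cell above the diagonal touches it only for j = i + 1, with its lower left corner (j,
  j). Correcting the height there is the only change, and it is the source of the hollowing.\<close>

lemma hollow_cell:
  assumes "extremal_caps k x y" "i < j" "j < 4 * k"
  shows "hollow_profile k x y i (Suc j) + hollow_profile k x y (Suc i) j
      - hollow_profile k x y i j - hollow_profile k x y (Suc i) (Suc j)
    = profile (4 * k) x y i (Suc j) + profile (4 * k) x y (Suc i) j
      - profile (4 * k) x y i j - profile (4 * k) x y (Suc i) (Suc j)
      + (if j = Suc i \<and> k < j \<and> j < 3 * k
         then (if even (j + k) then 2 * int k else 2 * y - 2 * int k) - x else 0)"
proof -
  have "diagonal_profile k y j - profile (4 * k) x y j j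
    = (if k < j \<and> j < 3 * k then (if even (j + k) then 2 * int k else 2 * y - 2 * int k) - x else 0)"
    using profile_diagonal[of k x j y] assms by (auto simp: diagonal_profile_def extremal_caps_def)
  then show ?thesis using assms(2) by (auto simp: hollow_profile_def)
qed

lemma fits_profile_hollowed_mat:
  assumes sym: "\<And>i j. 1 \<le> i \<Longrightarrow> i \<le> 4 * k \<Longrightarrow> 1 \<le> j \<Longrightarrow> j \<le> 4 * k \<Longrightarrow> f i j = f j i"
    and diag: "\<And>i. 1 \<le> i \<Longrightarrow> i \<le> 4 * k \<Longrightarrow> (\<exists>B\<in>\<B>. {i, i} \<subseteq> B) \<or> f i i = 0"
    and entry: "\<And>i j. i < j \<Longrightarrow> j < 4 * k \<Longrightarrow>
      2 * (if \<exists>B\<in>\<B>. {Suc i, Suc j} \<subseteq> B then 0 else f (Suc i) (Suc j))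
      = hollow_profile k x y i (Suc j) + hollow_profile k x y (Suc i) j
        - hollow_profile k x y i j - hollow_profile k x y (Suc i) (Suc j)"
  shows "fits_profile k x y (hollowed_mat (4 * k) f \<B>)"
proof -
  have m: "hollowed_mat (4 * k) f \<B> $$ (i, j)
      = (if \<exists>B\<in>\<B>. {Suc i, Suc j} \<subseteq> B then 0 else f (Suc i) (Suc j))" if "i < 4 * k" "j < 4 * k" for i j
    using that by (auto simp: hollowed_mat_def)
  have "hollowed_mat (4 * k) f \<B> $$ (i, i) = 0" if "i < 4 * k" for i
    unfolding m[OF that that] using diag[of "Suc i"] that by auto
  moreover have "hollowed_mat (4 * k) f \<B> $$ (i, j) = hollowed_mat (4 * k) f \<B> $$ (j, i)"
    if "i < 4 * k" "j < 4 * k" for i j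
    unfolding m[OF that] m[OF that(2,1)] insert_commute[of "Suc j" "Suc i" "{}"]
    using sym[of "Suc i" "Suc j"] that by auto
  moreover have "2 * hollowed_mat (4 * k) f \<B> $$ (i, j)
      = hollow_profile k x y i (Suc j) + hollow_profile k x y (Suc i) j
        - hollow_profile k x y i j - hollow_profile k x y (Suc i) (Suc j)" if "i < j" "j < 4 * k" for i j
    using entry[OF that] m[of i j] that by simp
  moreover have "hollowed_mat (4 * k) f \<B> \<in> carrier_mat (4 * k) (4 * k)" by (simp add: hollowed_mat_def)
  ultimately show ?thesis unfolding fits_profile_def by blast
qed

section \<open>Blocks and entries above the diagonal\<close>

definition odd_blocks :: "nat \<Rightarrow> nat set set" where
  "odd_blocks k = {{k + 2 * t - 1, k + 2 * t} | t. t \<in> {1..k}}"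

definition even_blocks :: "nat \<Rightarrow> nat set set" where
  "even_blocks k = {{k + 2 * t, k + 2 * t + 1} | t. t \<in> {1..k - 1}}"

text \<open>The blocks pair off the indices from k + 1 to 3k, so parity decides whether the partner
  of \<open>i\<close> is its successor or its predecessor.\<close>

lemma odd_blocks_iff:
  "(\<exists>B\<in>odd_blocks k. {i, j} \<subseteq> B) \<longleftrightarrow>
     k < i \<and> i \<le> 3 * k \<and> (j = i \<or> j = (if odd (i + k) then Suc i else i - 1))"
proof
  assume "\<exists>B\<in>odd_blocks k. {i, j} \<subseteq> B"
  then obtain t where t: "t \<in> {1..k}" "{i, j} \<subseteq> {k + 2 * t - 1, k + 2 * t}"
    unfolding odd_blocks_def by blast
  then have "i = k + 2 * t - 1 \<and> odd (i + k) \<or> i = k + 2 * t \<and> even (i + k)" by auto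
  with t show "k < i \<and> i \<le> 3 * k \<and> (j = i \<or> j = (if odd (i + k) then Suc i else i - 1))" by auto
next
  assume *: "k < i \<and> i \<le> 3 * k \<and> (j = i \<or> j = (if odd (i + k) then Suc i else i - 1))"
  obtain t where "t \<in> {1..k}" "i = (if odd (i + k) then k + 2 * t - 1 else k + 2 * t)"
  proof (cases "odd (i + k)")
    case True
    have "odd (i - k)" using True * by simp
    then obtain d where "i - k = 2 * d + 1" by (elim oddE)
    with True * show thesis by (intro that[of "d + 1"]) auto
  next
    case False
    have "even (i - k)" using False * by simp
    then obtain d where "i - k = 2 * d" by (elim evenE)
    with False * show thesis by (intro that[of d]) auto
  qed
  note i = this(2,1)
  have "{i, j} \<subseteq> {k + 2 * t - 1, k + 2 * t}"
    using * i by (cases "odd (i + k)") auto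
  with i(2) show "\<exists>B\<in>odd_blocks k. {i, j} \<subseteq> B" unfolding odd_blocks_def by blast
qed

lemma even_blocks_iff:
  "(\<exists>B\<in>even_blocks k. {i, j} \<subseteq> B) \<longleftrightarrow>
     Suc k < i \<and> i < 3 * k \<and> (j = i \<or> j = (if even (i + k) then Suc i else i - 1))"
proof
  assume "\<exists>B\<in>even_blocks k. {i, j} \<subseteq> B"
  then obtain t where t: "t \<in> {1..k - 1}" "{i, j} \<subseteq> {k + 2 * t, k + 2 * t + 1}"
    unfolding even_blocks_def by blast
  then have "i = k + 2 * t \<and> even (i + k) \<or> i = k + 2 * t + 1 \<and> odd (i + k)" by auto
  with t show "Suc k < i \<and> i < 3 * k \<and> (j = i \<or> j = (if even (i + k) then Suc i else i - 1))" by auto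
next
  assume *: "Suc k < i \<and> i < 3 * k \<and> (j = i \<or> j = (if even (i + k) then Suc i else i - 1))"
  obtain t where "t \<in> {1..k - 1}" "i = (if even (i + k) then k + 2 * t else k + 2 * t + 1)"
  proof (cases "even (i + k)")
    case True
    have "even (i - k)" using True * by simp
    then obtain d where "i - k = 2 * d" by (elim evenE)
    with True * show thesis by (intro that[of d]) auto
  next
    case False
    have "odd (i - k)" using False * by simp
    then obtain d where "i - k = 2 * d + 1" by (elim oddE)
    with False * show thesis by (intro that[of d]) auto
  qed
  note i = this(2,1)
  have "{i, j} \<subseteq> {k + 2 * t, k + 2 * t + 1}"
    using * i by (cases "even (i + k)") auto
  with i(2) show "\<exists>B\<in>even_blocks k. {i, j} \<subseteq> B" unfolding even_blocks_def by blast
qed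

lemma odd_blocks_less_iff:
  assumes "i < j"
  shows "(\<exists>B\<in>odd_blocks k. {i, j} \<subseteq> B) \<longleftrightarrow> k < i \<and> i < 3 * k \<and> j = Suc i \<and> odd (i + k)"
  unfolding odd_blocks_iff using assms by (cases "i = 3 * k") auto

lemma even_blocks_less_iff:
  assumes "i < j"
  shows "(\<exists>B\<in>even_blocks k. {i, j} \<subseteq> B) \<longleftrightarrow>
    Suc k < i \<and> i < 3 * k \<and> j = Suc i \<and> even (i + k)"
  unfolding even_blocks_iff using assms by auto

lemma power_minus_one_int: "(-1) ^ m = (if even m then 1 else -1 :: int)"
  by simp

lemma diamond_entry_less:
  assumes "i < j"
  shows "diamond_entry k (Suc i) (Suc j)
    = (if 2 * k \<le> i + j \<and> i + j + 2 \<le> 6 * k \<and> j \<le> i + 2 * k then if even (i + j) then 1 else -1 else 0)"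
  using assms unfolding diamond_entry_def Let_def power_minus_one_int by auto

lemma reversed_diamond_entry_less:
  assumes "i < j" "j < 4 * k"
  shows "reversed_diamond_entry k (Suc i) (Suc j)
    = (if 2 * k \<le> i + j + 1 \<and> i + j + 1 \<le> 6 * k \<and> j < i + 2 * k then if odd (i + j) then 1 else -1 else 0)"
proof -
  \<comment> \<open>The guard makes the truncated subtractions exact, so that parities can be
    compared.\<close>
  have "even (4 * k + 1 - Suc i + Suc j - 2 * k - 2) \<longleftrightarrow> odd (i + j)"
    if "2 * k + 2 \<le> 4 * k + 1 - Suc i + Suc j"
  proof -
    define e where "e = 4 * k + 1 - Suc i + Suc j - 2 * k - 2"
    have "e + 2 * k + 2 + i = 4 * k + 1 + j" using that assms unfolding e_def by simp
    then show ?thesis unfolding e_def[symmetric] by presburger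
  qed
  then show ?thesis
    using assms unfolding reversed_diamond_entry_def diamond_entry_def Let_def power_minus_one_int by auto
qed

lemma near_diamond_entry_less:
  assumes "i < j"
  shows "near_diamond_entry k (Suc i) (Suc j)
    = (if 2 * k + 1 \<le> i + j \<and> i + j + 2 \<le> 6 * k - 1 \<and> j \<le> i + 2 * k + 1
       then if odd (i + j) then 1 else -1 else 0)"
  using assms unfolding near_diamond_entry_def power_minus_one_int by auto

text \<open>For use with \<open>t\<close>: beside the middle of the diagonal; \<open>b\<close>: in a
  block; \<open>r\<close>: the entry; \<open>d\<close>: the diagonal correction. Inside a block the
  correction cancels the entry, elsewhere it is zero.\<close>

lemma hollowed_cell:
  fixes r d :: int
  assumes "b \<Longrightarrow> t" "t \<Longrightarrow> b \<Longrightarrow> 2 * r + d = 0" "t \<Longrightarrow> \<not> b \<Longrightarrow> d = 0"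
  shows "2 * (if b then 0 else r) = 2 * r + (if t then d else 0)"
  using assms by auto

section \<open>The three matrices realise the three pairs of caps\<close>

lemma fits_hollowed_diamond_1:
  assumes "1 \<le> k"
  shows "fits_profile k (2 * int k) (2 * int k + 1) (hollowed_diamond_1 k)"
  unfolding hollowed_diamond_1_def odd_blocks_def[symmetric]
proof (rule fits_profile_hollowed_mat)
  show "diamond_entry k i j = diamond_entry k j i" for i j
    by (simp add: diamond_entry_def Let_def add.commute abs_minus_commute)
  show "(\<exists>B\<in>odd_blocks k. {i, i} \<subseteq> B) \<or> diamond_entry k i i = 0" for i
    unfolding odd_blocks_iff by (auto simp: diamond_entry_def Let_def)
  fix i j assume ij: "i < j" "j < 4 * k"
  have caps: "extremal_caps k (2 * int k) (2 * int k + 1)" using assms by (simp add: extremal_caps_def)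
  have cell: "profile (4 * k) (2 * int k) (2 * int k + 1) i (Suc j)
      + profile (4 * k) (2 * int k) (2 * int k + 1) (Suc i) j
      - profile (4 * k) (2 * int k) (2 * int k + 1) i j
      - profile (4 * k) (2 * int k) (2 * int k + 1) (Suc i) (Suc j) = 2 * diamond_entry k (Suc i) (Suc j)"
  proof (cases "even (i + j)")
    case True
    then show ?thesis
      unfolding diamond_entry_less[OF ij(1)] using assms ij
      by (subst profile_cell[where e = 1 and e' = 1 and c = "2 * int k"]) auto
  next
    case False
    \<comment> \<open>For odd cells the cap 2k + 1 gives a range of i + j smaller by one at each end
      than \<open>diamond_entry\<close> does; parity excludes the two extra antidiagonals.\<close>
    then have "i + j \<noteq> 2 * k" "i + j + 2 \<noteq> 6 * k" by presburger+
    with False show ?thesis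
      unfolding diamond_entry_less[OF ij(1)] using assms ij
      by (subst profile_cell[where e = 1 and e' = "-1" and c = "2 * int k + 1"]) auto
  qed
  show "2 * (if \<exists>B\<in>odd_blocks k. {Suc i, Suc j} \<subseteq> B then 0 else diamond_entry k (Suc i) (Suc j)) =
      hollow_profile k (2 * int k) (2 * int k + 1) i (Suc j)
      + hollow_profile k (2 * int k) (2 * int k + 1) (Suc i) j
      - hollow_profile k (2 * int k) (2 * int k + 1) i j
      - hollow_profile k (2 * int k) (2 * int k + 1) (Suc i) (Suc j)"
    unfolding hollow_cell[OF caps ij] cell
  proof (rule hollowed_cell)
    note block = odd_blocks_less_iff[OF Suc_mono[OF ij(1)]]
    show "j = Suc i \<and> k < j \<and> j < 3 * k" if "\<exists>B\<in>odd_blocks k. {Suc i, Suc j} \<subseteq> B"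
      using that unfolding block by simp
    assume near: "j = Suc i \<and> k < j \<and> j < 3 * k"
    have entry: "diamond_entry k (Suc i) (Suc j) = -1"
      unfolding diamond_entry_less[OF ij(1)] using near by simp
    have iff: "(\<exists>B\<in>odd_blocks k. {Suc i, Suc j} \<subseteq> B) \<longleftrightarrow> odd (j + k)"
      unfolding block using near by (cases "i = k") auto
    show "2 * diamond_entry k (Suc i) (Suc j) + ((if even (j + k) then 2 * int k else 2 * (2 * int k + 1) - 2 * int k) - 2 * int k) = 0"
      if "\<exists>B\<in>odd_blocks k. {Suc i, Suc j} \<subseteq> B"
      using that[unfolded iff] entry by simp
    show "((if even (j + k) then 2 * int k else 2 * (2 * int k + 1) - 2 * int k) - 2 * int k) = 0"
      if "\<not> (\<exists>B\<in>odd_blocks k. {Suc i, Suc j} \<subseteq> B)"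
      using that[unfolded iff] by simp
  qed
qed

lemma fits_hollowed_diamond_2:
  assumes "1 \<le> k"
  shows "fits_profile k (2 * int k) (2 * int k - 1) (hollowed_diamond_2 k)"
  unfolding hollowed_diamond_2_def odd_blocks_def[symmetric]
proof (rule fits_profile_hollowed_mat)
  show "reversed_diamond_entry k i j = reversed_diamond_entry k j i"
    if "1 \<le> i" "i \<le> 4 * k" "1 \<le> j" "j \<le> 4 * k" for i j
  proof -
    have "2 * k + 2 \<le> 4 * k + 1 - i + j \<and> 4 * k + 1 - i + j \<le> 6 * k
        \<and> \<bar>int (4 * k + 1 - i) - int j\<bar> \<le> 2 * int k \<longleftrightarrow>
      2 * k + 2 \<le> 4 * k + 1 - j + i \<and> 4 * k + 1 - j + i \<le> 6 * k
        \<and> \<bar>int (4 * k + 1 - j) - int i\<bar> \<le> 2 * int k"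
      using that by auto
    moreover have "even (4 * k + 1 - i + j - 2 * k - 2) \<longleftrightarrow> even (4 * k + 1 - j + i - 2 * k - 2)"
      if "2 * k + 2 \<le> 4 * k + 1 - i + j" "2 * k + 2 \<le> 4 * k + 1 - j + i"
    proof -
      define e e' where "e = 4 * k + 1 - i + j - 2 * k - 2" and "e' = 4 * k + 1 - j + i - 2 * k - 2"
      have "e + 2 * k + 2 + i = 4 * k + 1 + j" "e' + 2 * k + 2 + j = 4 * k + 1 + i"
        using that \<open>i \<le> 4 * k\<close> \<open>j \<le> 4 * k\<close> unfolding e_def e'_def by simp_all
      then show ?thesis unfolding e_def[symmetric] e'_def[symmetric] by presburger
    qed
    ultimately show ?thesis
      unfolding reversed_diamond_entry_def diamond_entry_def Let_def power_minus_one_int by auto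
  qed
  show "(\<exists>B\<in>odd_blocks k. {i, i} \<subseteq> B) \<or> reversed_diamond_entry k i i = 0" if "1 \<le> i" "i \<le> 4 * k" for i
    unfolding odd_blocks_iff using that by (auto simp: reversed_diamond_entry_def diamond_entry_def Let_def)
  fix i j assume ij: "i < j" "j < 4 * k"
  have caps: "extremal_caps k (2 * int k) (2 * int k - 1)" using assms by (simp add: extremal_caps_def)
  have cell: "profile (4 * k) (2 * int k) (2 * int k - 1) i (Suc j)
      + profile (4 * k) (2 * int k) (2 * int k - 1) (Suc i) j
      - profile (4 * k) (2 * int k) (2 * int k - 1) i j
      - profile (4 * k) (2 * int k) (2 * int k - 1) (Suc i) (Suc j)
      = 2 * reversed_diamond_entry k (Suc i) (Suc j)"
  proof (cases "even (i + j)")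
    case True
    then have "i + j + 1 \<noteq> 2 * k" "i + j + 1 \<noteq> 6 * k" by presburger+
    with True show ?thesis
      unfolding reversed_diamond_entry_less[OF ij] using assms ij
      by (subst profile_cell[where e = "-1" and e' = "-1" and c = "2 * int k"]) auto
  next
    case False
    then show ?thesis
      unfolding reversed_diamond_entry_less[OF ij] using assms ij
      by (subst profile_cell[where e = "-1" and e' = 1 and c = "2 * int k - 1"]) auto
  qed
  show "2 * (if \<exists>B\<in>odd_blocks k. {Suc i, Suc j} \<subseteq> B then 0
        else reversed_diamond_entry k (Suc i) (Suc j)) =
      hollow_profile k (2 * int k) (2 * int k - 1) i (Suc j)
      + hollow_profile k (2 * int k) (2 * int k - 1) (Suc i) j
      - hollow_profile k (2 * int k) (2 * int k - 1) i j
      - hollow_profile k (2 * int k) (2 * int k - 1) (Suc i) (Suc j)"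
    unfolding hollow_cell[OF caps ij] cell
  proof (rule hollowed_cell)
    note block = odd_blocks_less_iff[OF Suc_mono[OF ij(1)]]
    show "j = Suc i \<and> k < j \<and> j < 3 * k" if "\<exists>B\<in>odd_blocks k. {Suc i, Suc j} \<subseteq> B"
      using that unfolding block by simp
    assume near: "j = Suc i \<and> k < j \<and> j < 3 * k"
    have entry: "reversed_diamond_entry k (Suc i) (Suc j) = 1"
      unfolding reversed_diamond_entry_less[OF ij] using near by simp
    have iff: "(\<exists>B\<in>odd_blocks k. {Suc i, Suc j} \<subseteq> B) \<longleftrightarrow> odd (j + k)"
      unfolding block using near by (cases "i = k") auto
    show "2 * reversed_diamond_entry k (Suc i) (Suc j) + ((if even (j + k) then 2 * int k else 2 * (2 * int k - 1) - 2 * int k) - 2 * int k) = 0"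
      if "\<exists>B\<in>odd_blocks k. {Suc i, Suc j} \<subseteq> B"
      using that[unfolded iff] entry by simp
    show "((if even (j + k) then 2 * int k else 2 * (2 * int k - 1) - 2 * int k) - 2 * int k) = 0"
      if "\<not> (\<exists>B\<in>odd_blocks k. {Suc i, Suc j} \<subseteq> B)"
      using that[unfolded iff] by simp
  qed
qed

lemma fits_hollowed_near_diamond:
  assumes "1 \<le> k"
  shows "fits_profile k (2 * int k + 2) (2 * int k + 1) (hollowed_near_diamond k)"
  unfolding hollowed_near_diamond_def even_blocks_def[symmetric]
proof (rule fits_profile_hollowed_mat)
  show "near_diamond_entry k i j = near_diamond_entry k j i" for i j
    by (simp add: near_diamond_entry_def add.commute abs_minus_commute)
  show "(\<exists>B\<in>even_blocks k. {i, i} \<subseteq> B) \<or> near_diamond_entry k i i = 0" for i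
    unfolding even_blocks_iff by (auto simp: near_diamond_entry_def)
  fix i j assume ij: "i < j" "j < 4 * k"
  have caps: "extremal_caps k (2 * int k + 2) (2 * int k + 1)" using assms by (simp add: extremal_caps_def)
  have cell: "profile (4 * k) (2 * int k + 2) (2 * int k + 1) i (Suc j)
      + profile (4 * k) (2 * int k + 2) (2 * int k + 1) (Suc i) j
      - profile (4 * k) (2 * int k + 2) (2 * int k + 1) i j
      - profile (4 * k) (2 * int k + 2) (2 * int k + 1) (Suc i) (Suc j)
      = 2 * near_diamond_entry k (Suc i) (Suc j)"
  proof (cases "even (i + j)")
    case True
    then have "i + j \<noteq> 2 * k + 1" "i + j + 2 \<noteq> 6 * k - 1" using assms by presburger+
    with True show ?thesis
      unfolding near_diamond_entry_less[OF ij(1)] using assms ij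
      by (subst profile_cell[where e = "-1" and e' = "-1" and c = "2 * int k + 2"]) auto
  next
    case False
    then show ?thesis
      unfolding near_diamond_entry_less[OF ij(1)] using assms ij
      by (subst profile_cell[where e = "-1" and e' = 1 and c = "2 * int k + 1"]) auto
  qed
  show "2 * (if \<exists>B\<in>even_blocks k. {Suc i, Suc j} \<subseteq> B then 0
        else near_diamond_entry k (Suc i) (Suc j)) =
      hollow_profile k (2 * int k + 2) (2 * int k + 1) i (Suc j)
      + hollow_profile k (2 * int k + 2) (2 * int k + 1) (Suc i) j
      - hollow_profile k (2 * int k + 2) (2 * int k + 1) i j
      - hollow_profile k (2 * int k + 2) (2 * int k + 1) (Suc i) (Suc j)"
    unfolding hollow_cell[OF caps ij] cell
  proof (rule hollowed_cell)
    note block = even_blocks_less_iff[OF Suc_mono[OF ij(1)]]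
    show "j = Suc i \<and> k < j \<and> j < 3 * k" if "\<exists>B\<in>even_blocks k. {Suc i, Suc j} \<subseteq> B"
      using that unfolding block by simp
    assume near: "j = Suc i \<and> k < j \<and> j < 3 * k"
    have entry: "near_diamond_entry k (Suc i) (Suc j) = 1"
      unfolding near_diamond_entry_less[OF ij(1)] using near by auto
    \<comment> \<open>The parity is opposite to that of the diamonds: the uncorrected diagonal value
      is now 2k + 2, and the correction to 2k takes place at even j + k.\<close>
    have iff: "(\<exists>B\<in>even_blocks k. {Suc i, Suc j} \<subseteq> B) \<longleftrightarrow> even (j + k)"
      unfolding block using near by (cases "i = k") auto
    show "2 * near_diamond_entry k (Suc i) (Suc j) + ((if even (j + k) then 2 * int k else 2 * (2 * int k + 1) - 2 * int k) - (2 * int k + 2)) = 0"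
      if "\<exists>B\<in>even_blocks k. {Suc i, Suc j} \<subseteq> B"
      using that[unfolded iff] entry by simp
    show "((if even (j + k) then 2 * int k else 2 * (2 * int k + 1) - 2 * int k) - (2 * int k + 2)) = 0"
      if "\<not> (\<exists>B\<in>even_blocks k. {Suc i, Suc j} \<subseteq> B)"
      using that[unfolded iff] by simp
  qed
qed

section \<open>Counting nonzero entries\<close>

lemma num_nonzero_hollowed_mat:
  "num_nonzero (hollowed_mat n f \<B>)
    = (\<Sum>i = 1..n. card {j \<in> {1..n}. \<not> (\<exists>B\<in>\<B>. {i, j} \<subseteq> B) \<and> f i j \<noteq> 0})"
proof -
  let ?M = "hollowed_mat n f \<B>"
  define P where "P i j \<longleftrightarrow> \<not> (\<exists>B\<in>\<B>. {i, j} \<subseteq> B) \<and> f i j \<noteq> 0" for i j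
  have "?M $$ (i, j) \<noteq> 0 \<longleftrightarrow> P (Suc i) (Suc j)" if "i < n" "j < n" for i j
    using that unfolding hollowed_mat_def P_def by simp
  moreover have "dim_row ?M = n" "dim_col ?M = n" by (simp_all add: hollowed_mat_def)
  ultimately have "{(i, j). i < dim_row ?M \<and> j < dim_col ?M \<and> ?M $$ (i, j) \<noteq> 0}
      = {(i, j). i < n \<and> j < n \<and> P (Suc i) (Suc j)}" by auto
  moreover have "bij_betw (\<lambda>(i, j). (Suc i, Suc j)) {(i, j). i < n \<and> j < n \<and> P (Suc i) (Suc j)}
      (SIGMA i : {1..n}. {j \<in> {1..n}. P i j})"
    by (rule bij_betw_byWitness[where f' = "\<lambda>(i, j). (i - 1, j - 1)"]) auto
  ultimately have "num_nonzero ?M = card (SIGMA i : {1..n}. {j \<in> {1..n}. P i j})"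
    by (simp add: num_nonzero_def bij_betw_same_card)
  then show ?thesis by (simp add: P_def)
qed

text \<open>A row of a hollowed matrix is supported on an interval, minus the diagonal position
  \<open>i\<close> and its partner \<open>i'\<close> if the row meets a block, which is what
  \<open>c\<close> says.\<close>

lemma card_row:
  assumes "\<And>j. j \<in> {1..n} \<Longrightarrow> P j \<longleftrightarrow> \<not> (c \<and> (j = i \<or> j = i')) \<and> a \<le> j \<and> j \<le> b"
    and "1 \<le> a" "a \<le> Suc b" "b \<le> n" "c \<Longrightarrow> a \<le> i \<and> i \<le> b \<and> a \<le> i' \<and> i' \<le> b \<and> i \<noteq> i'"
  shows "int (card {j \<in> {1..n}. P j}) = int b + 1 - int a - (if c then 2 else 0)"
proof (cases c)
  case True
  have "{j \<in> {1..n}. P j} = {a..b} - {i, i'}" using assms True by fastforce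
  moreover have "card ({a..b} - {i, i'}) = card {a..b} - 2"
    using assms(5)[OF True] by (subst card_Diff_subset) auto
  moreover have "2 \<le> card {a..b}"
    using assms(5)[OF True] card_mono[of "{a..b}" "{i, i'}"] by simp
  ultimately show ?thesis using True assms(3) by simp
next
  case False
  have "{j \<in> {1..n}. P j} = {a..b}" using assms False by fastforce
  then show ?thesis using False assms(3) by simp
qed

text \<open>Before hollowing, the rows of D and of D' have 1, 3, ..., 4k - 1, 4k - 1, ..., 3, 1
  nonzero entries.\<close>

lemma sum_row_lengths:
  "(\<Sum>i = 1..4 * k. if i \<le> 2 * k then 2 * int i - 1 else 8 * int k + 1 - 2 * int i) = 8 * int k * int k"
proof -
  let ?f = "\<lambda>i. if i \<le> 2 * k then 2 * int i - 1 else 8 * int k + 1 - 2 * int i"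
  have 1: "(\<Sum>i = 1..m. 2 * int i - 1) = int m * int m" for m
    by (induction m) (simp_all add: algebra_simps)
  have 2: "(\<Sum>i = Suc (2 * k)..2 * k + m. 8 * int k + 1 - 2 * int i) = int m * (4 * int k - int m)" for m
    by (induction m) (simp_all add: algebra_simps)
  have "{1..4 * k} = {1..2 * k} \<union> {Suc (2 * k)..2 * k + 2 * k}" by auto
  then have "(\<Sum>i = 1..4 * k. ?f i) = (\<Sum>i = 1..2 * k. ?f i) + (\<Sum>i = Suc (2 * k)..2 * k + 2 * k. ?f i)"
    by (simp add: sum.union_disjoint)
  also have "(\<Sum>i = 1..2 * k. ?f i) = (\<Sum>i = 1..2 * k. 2 * int i - 1)" by (intro sum.cong) auto
  also have "(\<Sum>i = Suc (2 * k)..2 * k + 2 * k. ?f i)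
      = (\<Sum>i = Suc (2 * k)..2 * k + 2 * k. 8 * int k + 1 - 2 * int i)" by (intro sum.cong) auto
  finally show ?thesis unfolding 1 2 by (simp add: algebra_simps)
qed

lemma sum_two_on:
  fixes S :: "nat set"
  assumes "S \<subseteq> {1..n}"
  shows "(\<Sum>i = 1..n. if i \<in> S then 2 else 0) = 2 * int (card S)"
proof -
  have "(\<Sum>i = 1..n. if i \<in> S then 2 else 0) = (\<Sum>i \<in> {1..n} \<inter> S. 2::int)"
    by (rule sum.inter_restrict[symmetric]) simp
  also have "{1..n} \<inter> S = S" using assms by auto
  finally show ?thesis by simp
qed

lemma num_nonzero_hollowed_diamond_1:
  "int (num_nonzero (hollowed_diamond_1 k)) = 8 * int k * int k - 4 * int k"
proof -
  have row: "int (card {j \<in> {1..4 * k}. \<not> (\<exists>B\<in>odd_blocks k. {i, j} \<subseteq> B) \<and> diamond_entry k i j \<noteq> 0})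
    = (if i \<le> 2 * k then 2 * int i - 1 else 8 * int k + 1 - 2 * int i) - (if i \<in> {Suc k..3 * k} then 2 else 0)"
    if "i \<in> {1..4 * k}" for i
  proof -
    define a b where "a = (if i \<le> 2 * k then 2 * k + 2 - i else i - 2 * k)"
      and "b = (if i \<le> 2 * k then 2 * k + i else 6 * k - i)"
    have "int (card {j \<in> {1..4 * k}. \<not> (\<exists>B\<in>odd_blocks k. {i, j} \<subseteq> B) \<and> diamond_entry k i j \<noteq> 0})
      = int b + 1 - int a - (if k < i \<and> i \<le> 3 * k then 2 else 0)"
    proof (rule card_row)
      fix j assume "j \<in> {1..4 * k}"
      then have "diamond_entry k i j \<noteq> 0 \<longleftrightarrow> a \<le> j \<and> j \<le> b"
        using that unfolding diamond_entry_def a_def b_def Let_def by auto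
      then show "\<not> (\<exists>B\<in>odd_blocks k. {i, j} \<subseteq> B) \<and> diamond_entry k i j \<noteq> 0 \<longleftrightarrow>
          \<not> ((k < i \<and> i \<le> 3 * k) \<and> (j = i \<or> j = (if odd (i + k) then Suc i else i - 1))) \<and> a \<le> j \<and> j \<le> b"
        unfolding odd_blocks_iff by blast
    next
      assume *: "k < i \<and> i \<le> 3 * k"
      have "i \<noteq> 3 * k" if "odd (i + k)" using that by auto
      moreover have "i \<noteq> Suc k" if "even (i + k)" using that by auto
      ultimately show "a \<le> i \<and> i \<le> b \<and> a \<le> (if odd (i + k) then Suc i else i - 1)
          \<and> (if odd (i + k) then Suc i else i - 1) \<le> b \<and> i \<noteq> (if odd (i + k) then Suc i else i - 1)"
        using * unfolding a_def b_def by (cases "odd (i + k)") auto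
    qed (use that in \<open>auto simp: a_def b_def\<close>)
    then show ?thesis using that by (auto simp: a_def b_def)
  qed
  have "int (num_nonzero (hollowed_diamond_1 k))
    = (\<Sum>i = 1..4 * k. (if i \<le> 2 * k then 2 * int i - 1 else 8 * int k + 1 - 2 * int i)
        - (if i \<in> {Suc k..3 * k} then 2 else 0))"
    unfolding hollowed_diamond_1_def odd_blocks_def[symmetric] num_nonzero_hollowed_mat of_nat_sum
    by (rule sum.cong[OF refl]) (rule row)
  also have "\<dots> = 8 * int k * int k - 2 * int (card {Suc k..3 * k})"
    unfolding sum_subtractf sum_row_lengths by (subst sum_two_on) auto
  finally show ?thesis by simp
qed

lemma num_nonzero_hollowed_diamond_2:
  "int (num_nonzero (hollowed_diamond_2 k)) = 8 * int k * int k - 4 * int k"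
proof -
  have row: "int (card {j \<in> {1..4 * k}. \<not> (\<exists>B\<in>odd_blocks k. {i, j} \<subseteq> B)
      \<and> reversed_diamond_entry k i j \<noteq> 0})
    = (if i \<le> 2 * k then 2 * int i - 1 else 8 * int k + 1 - 2 * int i) - (if i \<in> {Suc k..3 * k} then 2 else 0)"
    if "i \<in> {1..4 * k}" for i
  proof -
    define a b where "a = (if i \<le> 2 * k then 2 * k + 1 - i else i + 1 - 2 * k)"
      and "b = (if i \<le> 2 * k then 2 * k + i - 1 else 6 * k + 1 - i)"
    have "int (card {j \<in> {1..4 * k}. \<not> (\<exists>B\<in>odd_blocks k. {i, j} \<subseteq> B)
        \<and> reversed_diamond_entry k i j \<noteq> 0})
      = int b + 1 - int a - (if k < i \<and> i \<le> 3 * k then 2 else 0)"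
    proof (rule card_row)
      fix j assume "j \<in> {1..4 * k}"
      then have "reversed_diamond_entry k i j \<noteq> 0 \<longleftrightarrow> a \<le> j \<and> j \<le> b"
        using that unfolding reversed_diamond_entry_def diamond_entry_def a_def b_def Let_def by auto
      then show "\<not> (\<exists>B\<in>odd_blocks k. {i, j} \<subseteq> B) \<and> reversed_diamond_entry k i j \<noteq> 0 \<longleftrightarrow>
          \<not> ((k < i \<and> i \<le> 3 * k) \<and> (j = i \<or> j = (if odd (i + k) then Suc i else i - 1))) \<and> a \<le> j \<and> j \<le> b"
        unfolding odd_blocks_iff by blast
    next
      assume *: "k < i \<and> i \<le> 3 * k"
      have "i \<noteq> 3 * k" if "odd (i + k)" using that by auto
      moreover have "i \<noteq> Suc k" if "even (i + k)" using that by auto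
      ultimately show "a \<le> i \<and> i \<le> b \<and> a \<le> (if odd (i + k) then Suc i else i - 1)
          \<and> (if odd (i + k) then Suc i else i - 1) \<le> b \<and> i \<noteq> (if odd (i + k) then Suc i else i - 1)"
        using * unfolding a_def b_def by (cases "odd (i + k)") auto
    qed (use that in \<open>auto simp: a_def b_def\<close>)
    then show ?thesis using that by (auto simp: a_def b_def)
  qed
  have "int (num_nonzero (hollowed_diamond_2 k))
    = (\<Sum>i = 1..4 * k. (if i \<le> 2 * k then 2 * int i - 1 else 8 * int k + 1 - 2 * int i)
        - (if i \<in> {Suc k..3 * k} then 2 else 0))"
    unfolding hollowed_diamond_2_def odd_blocks_def[symmetric] num_nonzero_hollowed_mat of_nat_sum
    by (rule sum.cong[OF refl]) (rule row)
  also have "\<dots> = 8 * int k * int k - 2 * int (card {Suc k..3 * k})"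
    unfolding sum_subtractf sum_row_lengths by (subst sum_two_on) auto
  finally show ?thesis by simp
qed

text \<open>Compared with D, each of the two middle rows of E has two nonzero entries fewer; having
  one block fewer, and so four fewer deletions, makes up for it.\<close>

lemma num_nonzero_hollowed_near_diamond:
  assumes "1 \<le> k"
  shows "int (num_nonzero (hollowed_near_diamond k)) = 8 * int k * int k - 4 * int k"
proof -
  have row: "int (card {j \<in> {1..4 * k}. \<not> (\<exists>B\<in>even_blocks k. {i, j} \<subseteq> B) \<and> near_diamond_entry k i j \<noteq> 0})
    = (if i \<le> 2 * k then 2 * int i - 1 else 8 * int k + 1 - 2 * int i)
      - (if i \<in> {2 * k, 2 * k + 1} then 2 else 0) - (if i \<in> {k + 2..<3 * k} then 2 else 0)"
    if "i \<in> {1..4 * k}" for i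
  proof -
    define a b where "a = (if i \<le> 2 * k + 1 then 2 * k + 3 - i else i - 2 * k - 1)"
      and "b = (if i < 2 * k then 2 * k + 1 + i else 6 * k - 1 - i)"
    have ab: "1 \<le> a" "a \<le> Suc b" "b \<le> 4 * k" "int b + 1 - int a
      = (if i \<le> 2 * k then 2 * int i - 1 else 8 * int k + 1 - 2 * int i)
        - (if i \<in> {2 * k, 2 * k + 1} then 2 else 0)"
    proof (atomize (full), goal_cases)
      case 1
      consider "i < 2 * k" | "i = 2 * k" | "i = 2 * k + 1" | "2 * k + 1 < i" by linarith
      then show ?case using that assms unfolding a_def b_def by cases auto
    qed
    have "int (card {j \<in> {1..4 * k}. \<not> (\<exists>B\<in>even_blocks k. {i, j} \<subseteq> B) \<and> near_diamond_entry k i j \<noteq> 0})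
      = int b + 1 - int a - (if Suc k < i \<and> i < 3 * k then 2 else 0)"
    proof (rule card_row)
      fix j assume "j \<in> {1..4 * k}"
      then have "near_diamond_entry k i j \<noteq> 0 \<longleftrightarrow> a \<le> j \<and> j \<le> b"
        using that unfolding near_diamond_entry_def a_def b_def by auto
      then show "\<not> (\<exists>B\<in>even_blocks k. {i, j} \<subseteq> B) \<and> near_diamond_entry k i j \<noteq> 0 \<longleftrightarrow>
          \<not> ((Suc k < i \<and> i < 3 * k) \<and> (j = i \<or> j = (if even (i + k) then Suc i else i - 1))) \<and> a \<le> j \<and> j \<le> b"
        unfolding even_blocks_iff by blast
    next
      assume *: "Suc k < i \<and> i < 3 * k"
      have "i \<noteq> 3 * k - 1" if "even (i + k)" using that assms by auto
      moreover have "i \<noteq> k + 2" if "odd (i + k)" using that by auto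
      ultimately show "a \<le> i \<and> i \<le> b \<and> a \<le> (if even (i + k) then Suc i else i - 1)
          \<and> (if even (i + k) then Suc i else i - 1) \<le> b \<and> i \<noteq> (if even (i + k) then Suc i else i - 1)"
        using * unfolding a_def b_def by (cases "even (i + k)") auto
    qed (use ab in auto)
    then show ?thesis using ab(4) by simp
  qed
  have "int (num_nonzero (hollowed_near_diamond k))
    = (\<Sum>i = 1..4 * k. (if i \<le> 2 * k then 2 * int i - 1 else 8 * int k + 1 - 2 * int i)
      - (if i \<in> {2 * k, 2 * k + 1} then 2 else 0) - (if i \<in> {k + 2..<3 * k} then 2 else 0))"
    unfolding hollowed_near_diamond_def even_blocks_def[symmetric] num_nonzero_hollowed_mat of_nat_sum
    by (rule sum.cong[OF refl]) (rule row)
  also have "\<dots> = 8 * int k * int k - 2 * int (card {2 * k, 2 * k + 1}) - 2 * int (card {k + 2..<3 * k})"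
    unfolding sum_subtractf sum_row_lengths
    using assms by (subst (1 2) sum_two_on) auto
  finally show ?thesis using assms by (simp add: of_nat_diff)
qed

section \<open>The maximum and the matrices attaining it\<close>

lemma extremal_matrix_properties:
  assumes "1 \<le> k" "A \<in> {hollowed_diamond_1 k, hollowed_diamond_2 k, hollowed_near_diamond k}"
  shows "hollow_symmetric_asm (4 * k) A" "int (num_nonzero A) = 8 * int k * int k - 4 * int k"
proof -
  have "extremal_caps k (2 * int k) (2 * int k + 1)" "extremal_caps k (2 * int k) (2 * int k - 1)"
    "extremal_caps k (2 * int k + 2) (2 * int k + 1)"
    using assms(1) by (simp_all add: extremal_caps_def)
  then show "hollow_symmetric_asm (4 * k) A"
    using assms hollow_symmetric_asm_if_fits_profile fits_hollowed_diamond_1 fits_hollowed_diamond_2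
      fits_hollowed_near_diamond by blast
  show "int (num_nonzero A) = 8 * int k * int k - 4 * int k"
    using assms num_nonzero_hollowed_diamond_1 num_nonzero_hollowed_diamond_2
      num_nonzero_hollowed_near_diamond by blast
qed

lemma num_nonzero_le_and_extremal:
  assumes "hollow_symmetric_asm (4 * k) A" "1 \<le> k"
  shows "int (num_nonzero A) \<le> 8 * int k * int k - 4 * int k"
    and "int (num_nonzero A) = 8 * int k * int k - 4 * int k \<Longrightarrow>
      A \<in> {hollowed_diamond_1 k, hollowed_diamond_2 k, hollowed_near_diamond k}"
proof -
  let ?h = "height (\<lambda>i j. A $$ (i, j))"
  let ?Z = "card (height_function.zero_cells (4 * k) ?h)"
  have A: "A \<in> carrier_mat (4 * k) (4 * k)" "asm_entries (4 * k) (\<lambda>i j. A $$ (i, j))"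
    "\<And>i. i < 4 * k \<Longrightarrow> A $$ (i, i) = 0" "transpose_mat A = A"
    using assms(1) unfolding hollow_symmetric_asm_def alternating_sign_matrix_iff by auto
  have sym: "A $$ (i, j) = A $$ (j, i)" if "i < 4 * k" "j < 4 * k" for i j
    using A(1,4) that by (metis carrier_matD index_transpose_mat(1))
  interpret height_function "4 * k" k ?h
    using A(2) sym A(3) refl assms(2) by (rule height_function_height)
  have "num_nonzero A + 2 * ?Z = 4 * k * (4 * k - 1)"
    using assms by (intro num_nonzero_eq) auto
  then have "int (num_nonzero A + 2 * ?Z) = int (4 * k * (4 * k - 1))" by simp
  then have N: "int (num_nonzero A) + 2 * int ?Z = 16 * int k * int k - 4 * int k"
    using assms(2) by (simp add: of_nat_diff algebra_simps)
  have "int (4 * k * k) \<le> int ?Z" using zero_cells_ge by (simp only: of_nat_le_iff)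
  then have ge: "4 * int k * int k \<le> int ?Z" by simp
  with N show "int (num_nonzero A) \<le> 8 * int k * int k - 4 * int k" by linarith
  assume "int (num_nonzero A) = 8 * int k * int k - 4 * int k"
  with N have "int ?Z = int (4 * k * k)" by simp
  then have "?Z = 4 * k * k" by (simp only: of_nat_eq_iff)
  then obtain x y where xy: "extremal_caps k x y" "fits_profile k x y A"
    using tight_fits_profile[OF assms(1) refl assms(2)] by blast
  then show "A \<in> {hollowed_diamond_1 k, hollowed_diamond_2 k, hollowed_near_diamond k}"
    using fits_profile_unique[OF xy(2)] fits_hollowed_diamond_1[OF assms(2)]
      fits_hollowed_diamond_2[OF assms(2)] fits_hollowed_near_diamond[OF assms(2)]
    unfolding extremal_caps_def by blast
qed

section \<open>Translation to signed graphs\<close>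

lemma num_nonzero_signed_adjacency_mat:
  assumes "alternating_loopless_signed_graph n E \<sigma>"
  shows "num_nonzero (signed_adjacency_mat n E \<sigma>) = 2 * card E"
proof -
  let ?A = "signed_adjacency_mat n E \<sigma>"
  let ?U = "{(i, j). i < j \<and> j < n \<and> {Suc i, Suc j} \<in> E}"
  have E: "e \<subseteq> {1..n} \<and> card e = 2 \<and> \<sigma> e \<noteq> 0" if "e \<in> E" for e
    using assms that unfolding alternating_loopless_signed_graph_def loopless_signed_graph_def by force
  have "?A $$ (i, j) \<noteq> 0 \<longleftrightarrow> {Suc i, Suc j} \<in> E" if "i < j" "j < n" for i j
    using that E by (auto simp: signed_adjacency_mat_def)
  then have U: "{(i, j). i < j \<and> j < n \<and> ?A $$ (i, j) \<noteq> 0} = ?U" by blast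
  have "E = (\<lambda>(i, j). {Suc i, Suc j}) ` ?U"
  proof (intro equalityI subsetI)
    fix e assume e: "e \<in> E"
    then obtain u v where uv: "e = {u, v}" "u \<noteq> v" using E by (meson card_2_iff)
    define i j where "i = min u v - 1" and "j = max u v - 1"
    have "1 \<le> u" "1 \<le> v" "u \<le> n" "v \<le> n" using E[OF e] uv by auto
    then have "e = {Suc i, Suc j}" "i < j" "j < n"
      using uv unfolding i_def j_def by (auto simp: min_def max_def)
    with e show "e \<in> (\<lambda>(i, j). {Suc i, Suc j}) ` ?U" by force
  qed auto
  note E_image = this
  have "inj_on (\<lambda>(i, j). {Suc i, Suc j}) ?U"
    by (auto simp: inj_on_def doubleton_eq_iff)
  from card_image[OF this] have "card E = card ?U" unfolding E_image[symmetric] .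
  then show ?thesis
    using num_nonzero_upper[of n ?A] assms U unfolding alternating_loopless_signed_graph_def by simp
qed

text \<open>This carries the attained maximum over from matrices to graphs.\<close>

lemma signed_adjacency_mat_surj:
  assumes "hollow_symmetric_asm n A"
  obtains E \<sigma> where "loopless_signed_graph n E \<sigma>" "signed_adjacency_mat n E \<sigma> = A"
proof
  define E where "E = {{Suc i, Suc j} | i j. i < n \<and> j < n \<and> A $$ (i, j) \<noteq> 0}"
  \<comment> \<open>\<open>Min\<close> and \<open>Max\<close> recover an ordered pair from the edge
    and thus the entry above the diagonal; subtracting 1 undoes the index shift.\<close>
  define \<sigma> where "\<sigma> e = A $$ (Min e - 1, Max e - 1)" for e
  have A: "A \<in> carrier_mat n n" "asm_entries n (\<lambda>i j. A $$ (i, j))"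
    "\<And>i. i < n \<Longrightarrow> A $$ (i, i) = 0" "transpose_mat A = A"
    using assms unfolding hollow_symmetric_asm_def alternating_sign_matrix_iff by auto
  have sym: "A $$ (i, j) = A $$ (j, i)" if "i < n" "j < n" for i j
    using A(1,4) that by (metis carrier_matD index_transpose_mat(1))
  have \<sigma>: "\<sigma> {Suc i, Suc j} = A $$ (i, j)" if "i < n" "j < n" for i j
    using sym[OF that] unfolding \<sigma>_def by (cases i j rule: linorder_cases) auto
  have edge: "{Suc i, Suc j} \<in> E \<longleftrightarrow> A $$ (i, j) \<noteq> 0" if "i < n" "j < n" for i j
    using that sym by (auto simp: E_def doubleton_eq_iff)
  show "loopless_signed_graph n E \<sigma>"
    unfolding loopless_signed_graph_def
  proof (intro conjI ballI subsetI)
    fix e assume "e \<in> E"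
    then obtain i j where e: "e = {Suc i, Suc j}" "i < n" "j < n" "A $$ (i, j) \<noteq> 0"
      by (auto simp: E_def)
    have "i \<noteq> j" using e A(3) by auto
    with e show "e \<in> {e. e \<subseteq> {1..n} \<and> card e = 2}" by simp
    have "A $$ (i, j) \<in> {0, 1, -1}" using A(2) e(2,3) unfolding asm_entries_def by blast
    with e(4) show "\<sigma> e = 1 \<or> \<sigma> e = -1" unfolding e(1) \<sigma>[OF e(2,3)] by simp
  qed
  show "signed_adjacency_mat n E \<sigma> = A"
    using A(1) edge \<sigma> by (intro eq_matI) (auto simp: signed_adjacency_mat_def)
qed

theorem theorem5p1:
  fixes n k :: nat
  assumes "k \<ge> 1" and "n = 4 * k"
  shows "((\<exists>A. hollow_symmetric_asm n A \<and>
              real (num_nonzero A) = (real n ^ 2 - 2 * real n) / 2) \<and>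
          (\<forall>A. hollow_symmetric_asm n A \<longrightarrow>
              real (num_nonzero A) \<le> (real n ^ 2 - 2 * real n) / 2)) \<and>
         ((\<exists>E \<sigma>. alternating_loopless_signed_graph n E \<sigma> \<and>
              real (card E) = (real n ^ 2 - 2 * real n) / 4) \<and>
          (\<forall>E \<sigma>. alternating_loopless_signed_graph n E \<sigma> \<longrightarrow>
              real (card E) \<le> (real n ^ 2 - 2 * real n) / 4)) \<and>
         (\<forall>A. hollow_symmetric_asm n A \<longrightarrow>
            (real (num_nonzero A) = (real n ^ 2 - 2 * real n) / 2 \<longleftrightarrow>
             A = hollowed_diamond_1 k \<or> A = hollowed_diamond_2 k \<or> A = hollowed_near_diamond k))"
proof -
  let ?max = "real_of_int (8 * int k * int k - 4 * int k)"
  have half: "(real n ^ 2 - 2 * real n) / 2 = ?max"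
    and quarter: "(real n ^ 2 - 2 * real n) / 4 = ?max / 2"
    by (simp_all add: assms(2) power2_eq_square field_simps)
  have num: "real (num_nonzero A) \<le> ?max \<longleftrightarrow> int (num_nonzero A) \<le> 8 * int k * int k - 4 * int k"
    "real (num_nonzero A) = ?max \<longleftrightarrow> int (num_nonzero A) = 8 * int k * int k - 4 * int k" for A
    by (metis of_int_le_iff of_int_of_nat_eq, metis of_int_eq_iff of_int_of_nat_eq)
  have le: "real (num_nonzero A) \<le> ?max" if "hollow_symmetric_asm n A" for A
    unfolding num using num_nonzero_le_and_extremal(1) that assms by blast
  have extremal: "real (num_nonzero A) = ?max \<longleftrightarrow>
      A = hollowed_diamond_1 k \<or> A = hollowed_diamond_2 k \<or> A = hollowed_near_diamond k"
    if "hollow_symmetric_asm n A" for A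
    unfolding num using num_nonzero_le_and_extremal(2)[of k A] extremal_matrix_properties(2)[of k A]
      that assms by blast
  have D: "hollow_symmetric_asm n (hollowed_diamond_1 k)"
    using extremal_matrix_properties(1)[of k "hollowed_diamond_1 k"] assms by simp
  have D_max: "real (num_nonzero (hollowed_diamond_1 k)) = ?max" using extremal[OF D] by simp
  have graph: "2 * real (card E) = real (num_nonzero (signed_adjacency_mat n E \<sigma>))"
    if "alternating_loopless_signed_graph n E \<sigma>" for E \<sigma>
    using num_nonzero_signed_adjacency_mat[OF that] by simp
  obtain E \<sigma> where E: "loopless_signed_graph n E \<sigma>" "signed_adjacency_mat n E \<sigma> = hollowed_diamond_1 k"
    using signed_adjacency_mat_surj[OF D] by blast
  then have "alternating_loopless_signed_graph n E \<sigma>"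
    using D by (simp add: alternating_loopless_signed_graph_def)
  moreover from graph[OF this] have "real (card E) = ?max / 2" using E(2) D_max by simp
  moreover have "real (card F) \<le> ?max / 2" if "alternating_loopless_signed_graph n F \<tau>" for F \<tau>
  proof -
    have "hollow_symmetric_asm n (signed_adjacency_mat n F \<tau>)"
      using that by (simp add: alternating_loopless_signed_graph_def)
    from le[OF this] graph[OF that] show ?thesis by simp
  qed
  ultimately show ?thesis
    unfolding half quarter using le extremal D D_max by blast
qed

end
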